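(* For every positive integer $n$, the following identity of polynomials in $x$ and $q$ holds: $$\sum_T x^{v(T)} q^{r(T)} = \prod_{k=0}^{n-1} \left(1+xq^{2k+1}\right)^{n-k},$$ where $T$ ranges over all domino tilings of the Aztec diamond of order $n$, $v(T)$ is half the number of vertical dominoes in $T$, and $r(T)$ is the rank of $T$.
   Context: The Aztec diamond of order $n$ is the union of those lattice squares $[a,a+1]\times[b,b+1]\subset\mathbb{R}^2$ ($a,b\in\mathbb{Z}$) that lie completely inside the tilted square $\{(x,y): |x|+|y|\le n+1\}$. A domino is a closed $1\times 2$ or $2\times 1$ rectangle in $\mathbb{R}^2$ with corners in $\mathbb{Z}^2$; it is horizontal if its longer side is horizontal and vertical otherwise. A tiling of a region $R$ by dominoes is a set of dominoes whose interiors are disjoint and whose union is $R$. For a domino tiling $T$ of the Aztec diamond of order $n$, the number of vertical dominoes in $T$ is always even, and $v(T)$ denotes half that number. An elementary move converts one domino tiling of a region into another by removing two dominoes that together form a $2\times 2$ block and putting them back rotated by 90 degrees (so two horizontal dominoes filling the block are replaced by two vertical ones, or vice versa). Any domino tiling of the Aztec diamond of order $n$ can be reached from any other by a finite sequence of elementary moves. The rank $r(T)$ is the minimum number of elementary moves required to reach $T$ from the all-horizontals tiling, i.e. the unique tiling of the Aztec diamond of order $n$ all of whose dominoes are horizontal. *)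

theory Defs
  imports "HOL-Analysis.Analysis" "HOL-Computational_Algebra.Polynomial"
begin

type_synonym region = "(real \<times> real) set"

definition lattice_square :: "int \<Rightarrow> int \<Rightarrow> region" where
  "lattice_square a b =
     {real_of_int a .. real_of_int a + 1} \<times> {real_of_int b .. real_of_int b + 1}"

definition aztec_diamond :: "nat \<Rightarrow> region" where
  "aztec_diamond n =
     \<Union> {lattice_square a b | a b.
         lattice_square a b \<subseteq> {(x, y). \<bar>x\<bar> + \<bar>y\<bar> \<le> real n + 1}}"

definition hdomino :: "int \<Rightarrow> int \<Rightarrow> region" where
  "hdomino a b =
     {real_of_int a .. real_of_int a + 2} \<times> {real_of_int b .. real_of_int b + 1}"

definition vdomino :: "int \<Rightarrow> int \<Rightarrow> region" where
  "vdomino a b =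
     {real_of_int a .. real_of_int a + 1} \<times> {real_of_int b .. real_of_int b + 2}"

definition horizontal_domino :: "region \<Rightarrow> bool" where
  "horizontal_domino D \<longleftrightarrow> (\<exists>a b. D = hdomino a b)"

definition vertical_domino :: "region \<Rightarrow> bool" where
  "vertical_domino D \<longleftrightarrow> (\<exists>a b. D = vdomino a b)"

definition domino :: "region \<Rightarrow> bool" where
  "domino D \<longleftrightarrow> horizontal_domino D \<or> vertical_domino D"

definition domino_tiling :: "region \<Rightarrow> region set \<Rightarrow> bool" where
  "domino_tiling R T \<longleftrightarrow>
     (\<forall>D\<in>T. domino D) \<and>
     pairwise (\<lambda>D E. interior D \<inter> interior E = {}) T \<and>
     \<Union> T = R"

text \<open>For tilings of the Aztec diamond the number of vertical dominoes is even,
  so the integer division is exact there.\<close>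

definition half_verticals :: "region set \<Rightarrow> nat" where
  "half_verticals T = card {D \<in> T. vertical_domino D} div 2"

text \<open>The two ways of filling the block with lower left corner \<open>(a, b)\<close>.\<close>

definition hblock :: "int \<Rightarrow> int \<Rightarrow> region set" where
  "hblock a b = {hdomino a b, hdomino a (b + 1)}"

definition vblock :: "int \<Rightarrow> int \<Rightarrow> region set" where
  "vblock a b = {vdomino a b, vdomino (a + 1) b}"

definition elementary_moves :: "region \<Rightarrow> (region set \<times> region set) set" where
  "elementary_moves R =
     {(T, T'). domino_tiling R T \<and> domino_tiling R T' \<and>
        (\<exists>a b. (hblock a b \<subseteq> T \<and> T' = (T - hblock a b) \<union> vblock a b) \<or>
               (vblock a b \<subseteq> T \<and> T' = (T - vblock a b) \<union> hblock a b))}"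

definition all_horizontals :: "nat \<Rightarrow> region set" where
  "all_horizontals n =
     (THE T. domino_tiling (aztec_diamond n) T \<and> (\<forall>D\<in>T. horizontal_domino D))"

definition tiling_rank :: "nat \<Rightarrow> region set \<Rightarrow> nat" where
  "tiling_rank n T =
     (LEAST k. (all_horizontals n, T) \<in> elementary_moves (aztec_diamond n) ^^ k)"

text \<open>The polynomial ring \<open>\<int>[x, q]\<close> is represented as \<open>(\<int>[q])[x]\<close>.\<close>

definition indet_x :: "int poly poly" where
  "indet_x = [:0, 1:]"

definition indet_q :: "int poly poly" where
  "indet_q = [:[:0, 1:]:]"

end

theory Submission
  imports Defs "HOL-Computational_Algebra.Polynomial_Factorial"
begin

text \<open>
  A tiling of the Aztec diamond of order \<open>n\<close> is the same thing as a height function: an integer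
  function \<open>h\<close> on the lattice points with \<open>h x (y + 1) - h x y \<in> {0, 1}\<close>, with \<open>h\<close> at an odd point minus
  \<open>h\<close> at a horizontally adjacent even point in \<open>{0, 1}\<close> (the parity is that of \<open>x + y + n\<close>), and with
  \<open>h x y = max 0 y\<close> whenever \<open>\<bar>x\<bar> + \<bar>y\<bar> \<ge> n\<close>. The vertical dominoes are those whose two squares are
  separated by a horizontal lattice edge along which \<open>h\<close> changes, and the horizontal dominoes are found similarly
  from the vertical edges (\<open>bij_betw_tiling_of\<close>). The all-horizontals tiling is the pointwise smallest height
  function \<open>max 0 y\<close>.

  An elementary move changes \<open>h\<close> by \<open>\<plusminus>1\<close> at the centre of the block and nowhere else, and every
  \<open>h\<close> other than the smallest one can be lowered at some point (\<open>lowerable_vertex\<close>). Hence the rank is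
  the total excess of \<open>h\<close> over \<open>max 0 y\<close>. Counting the edges along which \<open>h\<close> changes shows that
  half the number of vertical dominoes is the excess at odd points minus the excess at even points.

  It remains to sum \<open>x\<close> and \<open>q\<close> raised to these powers over all height functions. The points with
  \<open>x + y + n = j\<close> form a diagonal, and \<open>h\<close> restricted to a diagonal encodes an integer partition, whose
  size is the excess on this diagonal. In these terms a height function is a sequence of partitions that starts
  and ends with the empty one and in which a horizontal strip is added and a vertical strip is removed
  alternately. If adding a strip of size \<open>k\<close> costs \<open>a ^ k\<close>, and removing one costs \<open>b ^ k\<close>, then exchanging
  an adding step with a removing step that follows it changes the generating function by the factor
  \<open>1 + a * b\<close> (\<open>strip_commutation\<close>). Once all removing steps have moved to the front, nothing but the
  constant sequence is left. So the generating function with weights \<open>a i\<close> and \<open>b j\<close> is the product of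
  \<open>1 + a i * b j\<close> over \<open>i \<le> j < n\<close> (\<open>gf_zigzag\<close>). The weights \<open>a i = q ^ (- 2 * i)\<close> and
  \<open>b j = x * q ^ (2 * j + 1)\<close> record the two statistics (\<open>zigzag_weight\<close>). As they involve the inverse
  of \<open>q\<close>, this part takes place in the field of fractions of \<open>\<int>[q][x]\<close>.
\<close>

section \<open>Partitions as profiles and the commutation of strips\<close>

text \<open>The profile of the empty partition, and at the same time the height function of the all-horizontals tiling.\<close>

definition vac :: "int \<Rightarrow> int" where
  "vac y = max 0 y"

text \<open>A partition \<open>\<lambda>\<close> is encoded by the function that maps \<open>y\<close> to \<open>vac y\<close> plus the number of
  boxes of content \<open>- y\<close> in the diagram of \<open>\<lambda>\<close>. Equivalently, \<open>f y\<close> counts the \<open>i\<close> with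
  \<open>\<lambda>\<^sub>i - i \<ge> - y\<close>. With this encoding neighbouring partitions in a sequence constrain each other
  pointwise.\<close>

definition profiles :: "(int \<Rightarrow> int) set" where
  "profiles = {f. (\<forall>y. f y \<le> f (y + 1) \<and> f (y + 1) \<le> f y + 1) \<and>
                  (\<exists>m. \<forall>y. \<bar>y\<bar> \<ge> m \<longrightarrow> f y = vac y)}"

text \<open>The number of boxes of the partition.\<close>

definition psize :: "(int \<Rightarrow> int) \<Rightarrow> nat" where
  "psize f = (\<Sum>y | f y \<noteq> vac y. nat (f y - vac y))"

text \<open>In terms of partitions, the larger one is obtained from the smaller one by adding at most one box to each
  column. Writing \<open>\<mu>\<close> for the larger one, this is the interlacing
  \<open>\<mu>\<^sub>1 \<ge> \<lambda>\<^sub>1 \<ge> \<mu>\<^sub>2 \<ge> \<lambda>\<^sub>2 \<ge> \<dots>\<close>.\<close>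

definition hstrip :: "(int \<Rightarrow> int) \<Rightarrow> (int \<Rightarrow> int) \<Rightarrow> bool" where
  "hstrip f g \<longleftrightarrow> (\<forall>y. f y \<le> g y \<and> g y \<le> f (y - 1) + 1)"

text \<open>Here at most one box is added to each row.\<close>

definition vstrip :: "(int \<Rightarrow> int) \<Rightarrow> (int \<Rightarrow> int) \<Rightarrow> bool" where
  "vstrip f g \<longleftrightarrow> (\<forall>y. f y \<le> g y \<and> g y \<le> f (y + 1))"

lemma int_step_mono:
  fixes f :: "int \<Rightarrow> int"
  assumes "\<And>y. f y \<le> f (y + 1)" and "x \<le> y"
  shows "f x \<le> f y"
  using assms(2)
proof (induction y rule: int_ge_induct)
  case (step i)
  then show ?case using assms(1)[of i] by linarith
qed simp

lemma vac_profile [simp]: "vac \<in> profiles"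
  by (auto simp: profiles_def vac_def)

lemma profileD:
  assumes "f \<in> profiles"
  shows "f y \<le> f (y + 1)" "f (y + 1) \<le> f y + 1" "f (y - 1) \<le> f y" "f y \<le> f (y - 1) + 1"
proof -
  have *: "f z \<le> f (z + 1)" "f (z + 1) \<le> f z + 1" for z
    using assms by (auto simp: profiles_def)
  show "f y \<le> f (y + 1)" "f (y + 1) \<le> f y + 1" by (fact *)+
  show "f (y - 1) \<le> f y" "f y \<le> f (y - 1) + 1"
    using *[of "y - 1"] by simp_all
qed

lemma profile_vac:
  assumes "f \<in> profiles"
  obtains m where "m > 0" "\<And>y. \<bar>y\<bar> \<ge> m \<Longrightarrow> f y = vac y"
proof -
  obtain m where "\<forall>y. \<bar>y\<bar> \<ge> m \<longrightarrow> f y = vac y"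
    using assms by (auto simp: profiles_def)
  then show ?thesis by (intro that[of "max 1 m"]) auto
qed

text \<open>Far to the left \<open>f\<close> is \<open>0\<close> and it never decreases; far to the right it is \<open>y\<close>, and it
  never grows faster than \<open>y\<close>.\<close>

lemma ge_vac:
  assumes mono: "\<And>y. f y \<le> f (y + 1)" and lip: "\<And>y. f (y + 1) \<le> f y + 1"
    and m: "\<And>y. \<bar>y\<bar> \<ge> m \<Longrightarrow> f y = vac y"
  shows "vac y \<le> f y"
proof -
  define M where "M = \<bar>m\<bar> + \<bar>y\<bar>"
  have "f (- M) \<le> f y"
    by (rule int_step_mono) (use mono in \<open>auto simp: M_def\<close>)
  moreover have "y - f y \<le> M - f M"
    by (rule int_step_mono[where f = "\<lambda>y. y - f y"])
       (use lip in \<open>auto simp: M_def algebra_simps\<close>)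
  moreover have "f (- M) = 0" "f M = M"
    using m[of "- M"] m[of M] by (auto simp: M_def vac_def)
  ultimately show ?thesis by (auto simp: vac_def)
qed

lemma profile_ge_vac: "f \<in> profiles \<Longrightarrow> vac y \<le> f y"
  by (metis profile_vac profileD(1,2) ge_vac)

lemma psize_eq_sum:
  assumes "finite I" "\<And>y. y \<notin> I \<Longrightarrow> f y = vac y"
  shows "psize f = (\<Sum>y\<in>I. nat (f y - vac y))"
  unfolding psize_def using assms
  by (intro sum.mono_neutral_left) auto

lemma psize_eq_int_sum:
  assumes "finite I" "\<And>y. y \<notin> I \<Longrightarrow> f y = vac y" "\<And>y. vac y \<le> f y"
  shows "int (psize f) = (\<Sum>y\<in>I. f y - vac y)"
  using assms by (simp add: psize_eq_sum)

lemma psize_vac [simp]: "psize vac = 0"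
  by (simp add: psize_def)

lemma psize_diff:
  assumes I: "finite I" and "\<And>y. y \<notin> I \<Longrightarrow> f y = vac y" "\<And>y. y \<notin> I \<Longrightarrow> g y = vac y"
    and "\<And>y. vac y \<le> f y" and le: "\<And>y. f y \<le> g y"
  shows "psize g - psize f = (\<Sum>y\<in>I. nat (g y - f y))"
proof -
  have "vac y \<le> g y" for y using assms(4)[of y] le[of y] by linarith
  then have "int (psize g) - int (psize f) = (\<Sum>y\<in>I. g y - f y)"
    using assms by (simp add: psize_eq_int_sum sum_subtractf)
  also have "\<dots> = int (\<Sum>y\<in>I. nat (g y - f y))"
    using le by simp
  finally show ?thesis by linarith
qed

lemma box_point:
  fixes f :: "'i \<Rightarrow> int"
  assumes "f \<in> {f. \<forall>y. L y \<le> f y \<and> f y \<le> U y}" "L y = c" "U y = c"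
  shows "f y = c"
proof -
  have "L y \<le> f y" "f y \<le> U y" using assms(1) by blast+
  then show ?thesis using assms(2,3) by linarith
qed

text \<open>Functions confined to a box that is degenerate outside \<open>I\<close> are determined by their values on
  \<open>I\<close>, which can be chosen independently; this turns sums over profiles into products.\<close>

lemma bij_betw_restrict_box:
  fixes L U :: "'i \<Rightarrow> int"
  assumes "\<And>y. y \<notin> I \<Longrightarrow> L y = U y"
  shows "bij_betw (\<lambda>f. restrict f I) {f. \<forall>y. L y \<le> f y \<and> f y \<le> U y} (\<Pi>\<^sub>E y\<in>I. {L y..U y})"
proof (rule bij_betwI[where g = "\<lambda>f y. if y \<in> I then f y else L y"])
  show "(\<lambda>f. restrict f I) \<in> {f. \<forall>y. L y \<le> f y \<and> f y \<le> U y} \<rightarrow> (\<Pi>\<^sub>E y\<in>I. {L y..U y})"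
    by (rule funcsetI) (simp add: restrict_PiE_iff)
  show "(\<lambda>f y. if y \<in> I then f y else L y) \<in>
      (\<Pi>\<^sub>E y\<in>I. {L y..U y}) \<rightarrow> {f. \<forall>y. L y \<le> f y \<and> f y \<le> U y}"
  proof (rule funcsetI)
    fix f assume "f \<in> (\<Pi>\<^sub>E y\<in>I. {L y..U y})"
    then have "L y \<le> (if y \<in> I then f y else L y)" "(if y \<in> I then f y else L y) \<le> U y" for y
      using assms[of y] by (auto simp: PiE_iff)
    then show "(\<lambda>y. if y \<in> I then f y else L y) \<in> {f. \<forall>y. L y \<le> f y \<and> f y \<le> U y}"
      by blast
  qed
  show "(\<lambda>y. if y \<in> I then restrict f I y else L y) = f"
    if "f \<in> {f. \<forall>y. L y \<le> f y \<and> f y \<le> U y}" for f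
  proof
    fix y show "(if y \<in> I then restrict f I y else L y) = f y"
    proof (cases "y \<in> I")
      case False
      have "f y = L y" by (rule box_point[OF that refl]) (use assms False in metis)
      then show ?thesis using False by simp
    qed simp
  qed
  show "restrict (\<lambda>y. if y \<in> I then f y else L y) I = f" if "f \<in> (\<Pi>\<^sub>E y\<in>I. {L y..U y})" for f
  proof
    fix y show "restrict (\<lambda>y. if y \<in> I then f y else L y) I y = f y"
    proof (cases "y \<in> I")
      case False
      then show ?thesis using PiE_arb[OF that False] by simp
    qed simp
  qed
qed

lemma finite_box:
  fixes L U :: "'i \<Rightarrow> int"
  assumes "finite I" "\<And>y. y \<notin> I \<Longrightarrow> L y = U y"
  shows "finite {f. \<forall>y. L y \<le> f y \<and> f y \<le> U y}"
  using bij_betw_finite[OF bij_betw_restrict_box[of I L U]] assms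
  by (simp add: finite_PiE)

lemma sum_box_prod:
  fixes L U :: "'i \<Rightarrow> int" and w :: "'i \<Rightarrow> int \<Rightarrow> 'a :: comm_ring_1"
  assumes "finite I" "\<And>y. y \<notin> I \<Longrightarrow> L y = U y"
  shows "(\<Sum>f | \<forall>y. L y \<le> f y \<and> f y \<le> U y. \<Prod>y\<in>I. w y (f y)) = (\<Prod>y\<in>I. \<Sum>v = L y..U y. w y v)"
proof -
  have "(\<Prod>y\<in>I. \<Sum>v = L y..U y. w y v) = (\<Sum>f\<in>(\<Pi>\<^sub>E y\<in>I. {L y..U y}). \<Prod>y\<in>I. w y (f y))"
    using assms by (intro prod_sum_PiE) auto
  also have "\<dots> = (\<Sum>f | \<forall>y. L y \<le> f y \<and> f y \<le> U y. \<Prod>y\<in>I. w y (restrict f I y))"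
    using assms by (intro sum.reindex_bij_betw[OF bij_betw_restrict_box, symmetric]) auto
  also have "\<dots> = (\<Sum>f | \<forall>y. L y \<le> f y \<and> f y \<le> U y. \<Prod>y\<in>I. w y (f y))"
    by (intro sum.cong prod.cong) auto
  finally show ?thesis by simp
qed

lemma atLeastAtMost_succ_int: "{x..x + 1} = {x, x + 1 :: int}"
  by auto

text \<open>The heart of the commutation relation. For fixed outer profiles, \<open>v\<close> and \<open>k\<close> are the possible
  values at one point of the profile in the middle, for the two orders of the steps. Each range has one or two
  elements. The two sums agree up to a power of \<open>1 + a * b\<close> that telescopes from point to point: if
  \<open>f\<close> and \<open>g\<close> are the outer profiles, then \<open>s = g (y + 1) - f y\<close>, and \<open>s'\<close> is the same quantity at
  \<open>y - 1\<close>.\<close>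

lemma local_commutation:
  fixes a b :: "'a :: comm_ring_1" and l l' m m' s s' :: int
  assumes "m = l' + s'" "m' = l + s" "s \<in> {0, 1}" "s' \<in> {0, 1}"
    and "l = l' \<or> l = l' + 1" "m' = m \<or> m' = m + 1"
  shows "(\<Sum>v = max l m..min (l' + 1) m'. a ^ nat (v - l) * b ^ nat (v - m)) * (1 + a * b) ^ nat s' =
         (\<Sum>k = max l' (m' - 1)..min l m. a ^ nat (m - k) * b ^ nat (l - k)) * (1 + a * b) ^ nat s"
  using assms(3-6) unfolding assms(1,2)
  by (auto simp: atLeastAtMost_succ_int max_def min_def atLeastAtMost_singleton')

text \<open>Between \<open>f\<close> and \<open>g\<close>, the values \<open>h y\<close> of the profile in the middle are independent of each
  other: \<open>h y\<close> ranges over an interval that depends on the values of \<open>f\<close> and \<open>g\<close> near \<open>y\<close>. So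
  both sums factor over \<open>y\<close>. Both are \<open>0\<close> unless \<open>g (y + 1) - f y \<in> {0, 1}\<close> for all
  \<open>y\<close>, and then \<open>local_commutation\<close> telescopes: this difference is \<open>0\<close> far to the left and
  \<open>1\<close> far to the right, which leaves a single factor \<open>1 + a * b\<close>.\<close>

lemma strip_commutation:
  fixes a b :: "'a :: comm_ring_1"
  assumes f: "f \<in> profiles" and g: "g \<in> profiles"
  shows "(\<Sum>h | h \<in> profiles \<and> hstrip f h \<and> vstrip g h.
             a ^ (psize h - psize f) * b ^ (psize h - psize g)) =
         (1 + a * b) * (\<Sum>k | k \<in> profiles \<and> vstrip k f \<and> hstrip k g.
             a ^ (psize g - psize k) * b ^ (psize f - psize k))"
proof -
  obtain mf where mf: "mf > 0" "\<And>y. \<bar>y\<bar> \<ge> mf \<Longrightarrow> f y = vac y"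
    using profile_vac[OF f] by blast
  obtain mg where mg: "mg > 0" "\<And>y. \<bar>y\<bar> \<ge> mg \<Longrightarrow> g y = vac y"
    using profile_vac[OF g] by blast
  define m where "m = max mf mg + 1"
  have m: "m > 1" "\<And>y. \<bar>y\<bar> \<ge> m - 1 \<Longrightarrow> f y = vac y" "\<And>y. \<bar>y\<bar> \<ge> m - 1 \<Longrightarrow> g y = vac y"
    using mf mg by (auto simp: m_def)
  define I where "I = {-m..m}"
  define L U L' U' where "L = (\<lambda>y. max (f y) (g y))" and "U = (\<lambda>y. min (f (y - 1) + 1) (g (y + 1)))"
    and "L' = (\<lambda>y. max (f (y - 1)) (g (y + 1) - 1))" and "U' = (\<lambda>y. min (f y) (g y))"
  note defs = L_def U_def L'_def U'_def
  note pf = profileD[OF f] profile_ge_vac[OF f]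
  note pg = profileD[OF g] profile_ge_vac[OF g]
  have finI: "finite I" by (simp add: I_def)
  have out: "L y = vac y" "U y = vac y" "L' y = vac y" "U' y = vac y" if "y \<notin> I" for y
  proof -
    have "\<bar>y\<bar> \<ge> m - 1" "\<bar>y - 1\<bar> \<ge> m - 1" "\<bar>y + 1\<bar> \<ge> m - 1" using that by (auto simp: I_def)
    then show "L y = vac y" "U y = vac y" "L' y = vac y" "U' y = vac y"
      using m(1) that by (auto simp: defs m(2,3)) (auto simp: vac_def I_def)
  qed
  have up: "{h. h \<in> profiles \<and> hstrip f h \<and> vstrip g h} = {h. \<forall>y. L y \<le> h y \<and> h y \<le> U y}"
    (is "?A = ?B")
  proof
    show "?A \<subseteq> ?B" by (auto simp: defs hstrip_def vstrip_def)
    show "?B \<subseteq> ?A"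
    proof
      fix h assume "h \<in> ?B"
      then have h: "f y \<le> h y" "g y \<le> h y" "h y \<le> f (y - 1) + 1" "h y \<le> g (y + 1)" for y
        by (auto simp: defs)
      have "h y = vac y" if "\<bar>y\<bar> \<ge> m + 1" for y
        
      proof -
        have "y \<notin> I" using that by (auto simp: I_def)
        then show ?thesis by (intro box_point[OF \<open>h \<in> ?B\<close>] out)
      qed
      moreover have "h y \<le> h (y + 1)" "h (y + 1) \<le> h y + 1" for y
        using h[of y] h[of "y + 1"] pf(1,2)[of y] pg(1,2)[of y] by auto
      ultimately have "h \<in> profiles" unfolding profiles_def by blast
      then show "h \<in> ?A" using h by (auto simp: hstrip_def vstrip_def)
    qed
  qed
  have down: "{k. k \<in> profiles \<and> vstrip k f \<and> hstrip k g} = {k. \<forall>y. L' y \<le> k y \<and> k y \<le> U' y}"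
    (is "?A = ?B")
  proof
    show "?A \<subseteq> ?B"
    proof
      fix k assume "k \<in> ?A"
      then have k: "k y \<le> f y" "f y \<le> k (y + 1)" "k y \<le> g y" "g y \<le> k (y - 1) + 1" for y
        by (auto simp: hstrip_def vstrip_def)
      have "f (y - 1) \<le> k y" "g (y + 1) - 1 \<le> k y" "k y \<le> f y" "k y \<le> g y" for y
        using k(2)[of "y - 1"] k(4)[of "y + 1"] k(1,3)[of y] by auto
      then show "k \<in> ?B" by (auto simp: defs)
    qed
    show "?B \<subseteq> ?A"
    proof
      fix k assume "k \<in> ?B"
      then have k: "k y \<le> f y" "k y \<le> g y" "f (y - 1) \<le> k y" "g (y + 1) - 1 \<le> k y" for y
        by (auto simp: defs)
      have "k y = vac y" if "\<bar>y\<bar> \<ge> m + 1" for y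
        
      proof -
        have "y \<notin> I" using that by (auto simp: I_def)
        then show ?thesis by (intro box_point[OF \<open>k \<in> ?B\<close>] out)
      qed
      moreover have "k y \<le> k (y + 1)" "k (y + 1) \<le> k y + 1" for y
        using k[of y] k[of "y + 1"] pf(1,2)[of y] pg(1,2)[of y] by auto
      ultimately have "k \<in> profiles" unfolding profiles_def by blast
      have "f y \<le> k (y + 1)" "g y \<le> k (y - 1) + 1" for y
        using k(3)[of "y + 1"] k(4)[of "y - 1"] by auto
      then show "k \<in> ?A" using k(1,2) \<open>k \<in> profiles\<close> by (auto simp: hstrip_def vstrip_def)
    qed
  qed
  define F where "F y = (\<Sum>v = L y..U y. a ^ nat (v - f y) * b ^ nat (v - g y))" for y
  define G where "G y = (\<Sum>k = L' y..U' y. a ^ nat (g y - k) * b ^ nat (f y - k))" for y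
  have fo: "f y = vac y" "g y = vac y" if "y \<notin> I" for y
    using m(2,3)[of y] that by (auto simp: I_def)
  have "(\<Sum>h | h \<in> profiles \<and> hstrip f h \<and> vstrip g h.
             a ^ (psize h - psize f) * b ^ (psize h - psize g)) =
        (\<Sum>h | \<forall>y. L y \<le> h y \<and> h y \<le> U y. \<Prod>y\<in>I. a ^ nat (h y - f y) * b ^ nat (h y - g y))"
    unfolding up
  proof (rule sum.cong[OF refl])
    fix h assume h: "h \<in> {h. \<forall>y. L y \<le> h y \<and> h y \<le> U y}"
    have ho: "h y = vac y" if "y \<notin> I" for y
      using out[OF that] by (intro box_point[OF h])
    have "f y \<le> h y" "g y \<le> h y" for y using h by (auto simp: defs)
    then show "a ^ (psize h - psize f) * b ^ (psize h - psize g) =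
        (\<Prod>y\<in>I. a ^ nat (h y - f y) * b ^ nat (h y - g y))"
      by (simp add: psize_diff[OF finI] ho fo pf pg prod.distrib power_sum)
  qed
  also have "\<dots> = (\<Prod>y\<in>I. F y)"
    unfolding F_def using finI out by (intro sum_box_prod) auto
  also have "\<dots> = (1 + a * b) * (\<Prod>y\<in>I. G y)"
  proof (cases "\<forall>y. f y \<le> g (y + 1) \<and> g (y + 1) \<le> f y + 1")
    case True
    define s where "s y = g (y + 1) - f y" for y
    have s01: "s y \<in> {0, 1}" for y using True[rule_format, of y] by (auto simp: s_def)
    have loc: "F y * (1 + a * b) ^ nat (s (y - 1)) = G y * (1 + a * b) ^ nat (s y)" for y
    proof -
      have "f y = f (y - 1) \<or> f y = f (y - 1) + 1" "g (y + 1) = g y \<or> g (y + 1) = g y + 1"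
        using pf(3,4)[of y] pg(1,2)[of y] by auto
      then show ?thesis unfolding F_def G_def defs
        using s01[of y] s01[of "y - 1"]
        by (intro local_commutation) (auto simp: s_def)
    qed
    \<comment> \<open>At the left end \<open>s\<close> vanishes, so the partial products differ by the last power only.\<close>
    have part: "(\<Prod>y\<in>{-m..k}. F y) = (\<Prod>y\<in>{-m..k}. G y) * (1 + a * b) ^ nat (s k)" if "k \<ge> -m" for k
      using that
    proof (induction k rule: int_ge_induct)
      case base
      have "s (- m - 1) = 0" using m by (simp add: s_def vac_def)
      then show ?case using loc[of "-m"] by simp
    next
      case (step i)
      have ins: "{-m..i + 1} = insert (i + 1) {-m..i}" using step.hyps by auto
      have "(\<Prod>y\<in>{-m..i + 1}. F y) = F (i + 1) * ((\<Prod>y\<in>{-m..i}. G y) * (1 + a * b) ^ nat (s i))"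
        using step.IH by (simp add: ins)
      also have "\<dots> = (\<Prod>y\<in>{-m..i}. G y) * (F (i + 1) * (1 + a * b) ^ nat (s (i + 1 - 1)))"
        by (simp add: algebra_simps)
      also have "\<dots> = (\<Prod>y\<in>{-m..i + 1}. G y) * (1 + a * b) ^ nat (s (i + 1))"
        unfolding loc by (simp add: ins mult_ac)
      finally show ?case .
    qed
    have "s m = 1" using m by (simp add: s_def vac_def)
    then show ?thesis using part[of m] m(1) by (simp add: I_def mult.commute)
  next
    case False
    then obtain y where y: "\<not> (f y \<le> g (y + 1) \<and> g (y + 1) \<le> f y + 1)" by blast
    have "\<exists>y y'. L y > U y \<and> L' y' > U' y'"
    proof (cases "f y \<le> g (y + 1)")
      case True
      then have "L (y + 1) > U (y + 1)" "L' y > U' y" using y by (auto simp: defs)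
      then show ?thesis by blast
    next
      case False
      then have "L y > U y" "L' (y + 1) > U' (y + 1)" by (auto simp: defs)
      then show ?thesis by blast
    qed
    then obtain y y' where y: "L y > U y" "L' y' > U' y'" by blast
    have "y \<in> I" using y(1) out(1,2)[of y] by (cases "y \<in> I") auto
    moreover have "y' \<in> I" using y(2) out(3,4)[of y'] by (cases "y' \<in> I") auto
    moreover have "F y = 0" "G y' = 0" using y by (simp_all add: F_def G_def)
    ultimately have "prod F I = 0" "prod G I = 0" using finI by (auto intro: prod_zero)
    then show ?thesis by simp
  qed
  also have "(\<Prod>y\<in>I. G y) =
      (\<Sum>k | \<forall>y. L' y \<le> k y \<and> k y \<le> U' y. \<Prod>y\<in>I. a ^ nat (g y - k y) * b ^ nat (f y - k y))"
    unfolding G_def using finI out by (intro sum_box_prod[symmetric]) auto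
  also have "\<dots> = (\<Sum>k | k \<in> profiles \<and> vstrip k f \<and> hstrip k g.
             a ^ (psize g - psize k) * b ^ (psize f - psize k))"
    unfolding down
  proof (rule sum.cong[OF refl])
    fix k assume k: "k \<in> {h. \<forall>y. L' y \<le> h y \<and> h y \<le> U' y}"
    have ko: "k y = vac y" if "y \<notin> I" for y
      using out[OF that] by (intro box_point[OF k])
    have "k \<in> profiles" using k down by auto
    from profile_ge_vac[OF this] have "vac y \<le> k y" for y .
    moreover have "k y \<le> f y" "k y \<le> g y" for y using k by (auto simp: defs)
    ultimately show "(\<Prod>y\<in>I. a ^ nat (g y - k y) * b ^ nat (f y - k y)) =
        a ^ (psize g - psize k) * b ^ (psize f - psize k)"
      by (simp add: psize_diff[OF finI] ko fo prod.distrib power_sum)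
  qed
  finally show ?thesis .
qed

section \<open>Generating functions of sequences of partitions\<close>

text \<open>\<open>Up a\<close> adds a horizontal strip, each box having weight \<open>a\<close>; \<open>Down b\<close> removes a
  vertical strip, each box having weight \<open>b\<close>.\<close>

datatype 'a letter = Up 'a | Down 'a

fun strip_step :: "'a letter \<Rightarrow> (int \<Rightarrow> int) \<Rightarrow> (int \<Rightarrow> int) \<Rightarrow> bool" where
  "strip_step (Up a) f g = hstrip f g"
| "strip_step (Down b) f g = vstrip g f"

fun step_weight :: "'a :: comm_ring_1 letter \<Rightarrow> (int \<Rightarrow> int) \<Rightarrow> (int \<Rightarrow> int) \<Rightarrow> 'a" where
  "step_weight (Up a) f g = a ^ (psize g - psize f)"
| "step_weight (Down b) f g = b ^ (psize f - psize g)"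

text \<open>The bound \<open>g y = 0\<close> for \<open>y \<le> - L\<close> says that the first row has length at most \<open>L\<close>. It holds
  for every partition that can be emptied in \<open>L\<close> steps, since a vertical strip takes at most one box from
  a row. Imposing it makes the set finite without changing the sequences that end with the empty partition.\<close>

definition next_profiles :: "'a letter \<Rightarrow> nat \<Rightarrow> (int \<Rightarrow> int) \<Rightarrow> (int \<Rightarrow> int) set" where
  "next_profiles s L f = {g \<in> profiles. strip_step s f g \<and> (\<forall>y \<le> - int L. g y = 0)}"

fun paths :: "'a letter list \<Rightarrow> (int \<Rightarrow> int) \<Rightarrow> (int \<Rightarrow> int) list set" where
  "paths [] f = (if f = vac then {[]} else {})"
| "paths (s # w) f = (\<Union>g\<in>next_profiles s (length w) f. (#) g ` paths w g)"

fun path_weight :: "'a :: comm_ring_1 letter list \<Rightarrow> (int \<Rightarrow> int) \<Rightarrow> (int \<Rightarrow> int) list \<Rightarrow> 'a" where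
  "path_weight (s # w) f (g # l) = step_weight s f g * path_weight w g l"
| "path_weight w f l = 1"

fun gf :: "'a :: comm_ring_1 letter list \<Rightarrow> (int \<Rightarrow> int) \<Rightarrow> 'a" where
  "gf [] f = of_bool (f = vac)"
| "gf (s # w) f = (\<Sum>g\<in>next_profiles s (length w) f. step_weight s f g * gf w g)"

lemma next_profiles_profile: "g \<in> next_profiles s L f \<Longrightarrow> g \<in> profiles"
  by (auto simp: next_profiles_def)

lemma finite_next_profiles:
  assumes "f \<in> profiles"
  shows "finite (next_profiles s L f)"
proof -
  obtain m where m: "m > 0" "\<And>y. \<bar>y\<bar> \<ge> m \<Longrightarrow> f y = vac y"
    using profile_vac[OF assms] by blast
  define U where "U y = (if y \<le> - int L then 0 else f (y - 1) + 1)" for y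
  define I where "I = {- m - int L..m + 1}"
  have "vac y = U y" if "y \<notin> I" for y
  proof -
    have "\<bar>y - 1\<bar> \<ge> m" "y \<le> - int L \<or> y > 1" using that m(1) by (auto simp: I_def)
    then show ?thesis using m(2)[of "y - 1"] by (auto simp: U_def vac_def)
  qed
  then have "finite {g. \<forall>y. vac y \<le> g y \<and> g y \<le> U y}"
    by (intro finite_box[of I]) (auto simp: I_def)
  moreover have "next_profiles s L f \<subseteq> {g. \<forall>y. vac y \<le> g y \<and> g y \<le> U y}"
  proof
    fix g assume "g \<in> next_profiles s L f"
    then have g: "g \<in> profiles" "strip_step s f g" "\<forall>y \<le> - int L. g y = 0"
      by (auto simp: next_profiles_def)
    have "g y \<le> f (y - 1) + 1" for y
    proof (cases s)
      case (Up a)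
      then show ?thesis using g(2) by (simp add: hstrip_def)
    next
      case (Down b)
      then have "g y \<le> f y" using g(2) by (simp add: vstrip_def)
      then show ?thesis using profileD(4)[OF assms, of y] by linarith
    qed
    then show "g \<in> {g. \<forall>y. vac y \<le> g y \<and> g y \<le> U y}"
      using g(3) profile_ge_vac[OF g(1)] by (auto simp: U_def)
  qed
  ultimately show ?thesis by (rule finite_subset[rotated])
qed

lemma finite_paths: "f \<in> profiles \<Longrightarrow> finite (paths w f)"
proof (induction w arbitrary: f)
  case (Cons s w)
  then show ?case
    using finite_next_profiles[OF Cons.prems] by (auto dest: next_profiles_profile)
qed simp

lemma gf_eq_sum_paths:
  "f \<in> profiles \<Longrightarrow> gf w f = (\<Sum>l\<in>paths w f. path_weight w f l)"
proof (induction w arbitrary: f)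
  case (Cons s w)
  have np: "g \<in> profiles" if "g \<in> next_profiles s (length w) f" for g
    using that by (rule next_profiles_profile)
  have "(\<Sum>l\<in>paths (s # w) f. path_weight (s # w) f l) =
      (\<Sum>g\<in>next_profiles s (length w) f. \<Sum>l\<in>(#) g ` paths w g. path_weight (s # w) f l)"
    using np finite_paths finite_next_profiles[OF Cons.prems]
    unfolding paths.simps by (intro sum.UNION_disjoint) auto
  also have "\<dots> = (\<Sum>g\<in>next_profiles s (length w) f. step_weight s f g * gf w g)"
    using Cons.IH np by (intro sum.cong) (auto simp: sum.reindex sum_distrib_left)
  finally show ?case by simp
qed simp

text \<open>Fixing the profile after the two steps reduces the claim to \<open>strip_commutation\<close>. The bounds on the profile in
  the middle hold automatically on both sides.\<close>

lemma gf_Up_Down: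
  fixes a b :: "'a :: comm_ring_1"
  assumes f: "f \<in> profiles"
  shows "gf (Up a # Down b # w) f = (1 + a * b) * gf (Down b # Up a # w) f"
proof -
  define L where "L = length w"
  let ?M = "next_profiles (Up a) (Suc L) f" and ?N = "next_profiles (Down b) (Suc L) f"
  \<comment> \<open>All profiles that can be reached by the two steps in either order.\<close>
  define B where "B = (\<Union>h\<in>?M. next_profiles (Down b) L h) \<union> (\<Union>k\<in>?N. next_profiles (Up a) L k)"
  have fin: "finite ?M" "finite ?N" using f by (simp_all add: finite_next_profiles)
  have "finite B" unfolding B_def using fin
    by (auto intro!: finite_next_profiles dest: next_profiles_profile)
  have B: "g \<in> profiles" "y \<le> - int L \<Longrightarrow> g y = 0" if "g \<in> B" for g y
    using that by (auto simp: B_def next_profiles_def)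
  have "gf (Up a # Down b # w) f =
      (\<Sum>h\<in>?M. \<Sum>g | g \<in> B \<and> vstrip g h. a ^ (psize h - psize f) * (b ^ (psize h - psize g) * gf w g))"
    by (auto simp: sum_distrib_left L_def[symmetric] intro!: sum.cong)
       (auto simp: next_profiles_def B_def)
  also have "\<dots> = (\<Sum>g\<in>B. \<Sum>h | h \<in> ?M \<and> vstrip g h.
      a ^ (psize h - psize f) * (b ^ (psize h - psize g) * gf w g))"
    by (rule sum.swap_restrict) fact+
  also have "\<dots> = (\<Sum>g\<in>B. (\<Sum>h | h \<in> profiles \<and> hstrip f h \<and> vstrip g h.
      a ^ (psize h - psize f) * b ^ (psize h - psize g)) * gf w g)"
  proof (rule sum.cong[OF refl])
    fix g assume g: "g \<in> B"
    have "h y = 0" if "h \<in> profiles" "vstrip g h" "y \<le> - int (Suc L)" for h y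
    proof -
      have "h y \<le> g (y + 1)" using that(2) by (simp add: vstrip_def)
      moreover have "g (y + 1) = 0" using that(3) B(2)[OF g, of "y + 1"] by simp
      ultimately have "h y \<le> 0" by simp
      then show ?thesis using profile_ge_vac[OF that(1), of y] by (simp add: vac_def)
    qed
    then have "{h. h \<in> ?M \<and> vstrip g h} = {h. h \<in> profiles \<and> hstrip f h \<and> vstrip g h}"
      by (auto simp: next_profiles_def)
    then show "(\<Sum>h | h \<in> ?M \<and> vstrip g h. a ^ (psize h - psize f) * (b ^ (psize h - psize g) * gf w g)) =
      (\<Sum>h | h \<in> profiles \<and> hstrip f h \<and> vstrip g h.
      a ^ (psize h - psize f) * b ^ (psize h - psize g)) * gf w g"
      by (simp add: sum_distrib_right mult.assoc)
  qed
  also have "\<dots> = (1 + a * b) * (\<Sum>g\<in>B. (\<Sum>k | k \<in> profiles \<and> vstrip k f \<and> hstrip k g.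
      a ^ (psize g - psize k) * b ^ (psize f - psize k)) * gf w g)"
    unfolding sum_distrib_left[of _ _ B]
    by (intro sum.cong refl) (simp add: strip_commutation[OF f B(1)] mult.assoc)
  also have "(\<Sum>g\<in>B. (\<Sum>k | k \<in> profiles \<and> vstrip k f \<and> hstrip k g.
      a ^ (psize g - psize k) * b ^ (psize f - psize k)) * gf w g) =
    (\<Sum>g\<in>B. \<Sum>k | k \<in> ?N \<and> hstrip k g. b ^ (psize f - psize k) * (a ^ (psize g - psize k) * gf w g))"
  proof (rule sum.cong[OF refl])
    fix g assume g: "g \<in> B"
    have "k y = 0" if "k \<in> profiles" "hstrip k g" "y \<le> - int (Suc L)" for k y
    proof -
      have "k y \<le> g y" using that(2) by (simp add: hstrip_def)
      moreover have "g y = 0" using that(3) B(2)[OF g, of y] by simp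
      ultimately have "k y \<le> 0" by simp
      then show ?thesis using profile_ge_vac[OF that(1), of y] by (simp add: vac_def)
    qed
    then have "{k. k \<in> ?N \<and> hstrip k g} = {k. k \<in> profiles \<and> vstrip k f \<and> hstrip k g}"
      by (auto simp: next_profiles_def)
    then show "(\<Sum>k | k \<in> profiles \<and> vstrip k f \<and> hstrip k g.
        a ^ (psize g - psize k) * b ^ (psize f - psize k)) * gf w g =
      (\<Sum>k | k \<in> ?N \<and> hstrip k g. b ^ (psize f - psize k) * (a ^ (psize g - psize k) * gf w g))"
      by (simp add: sum_distrib_left sum_distrib_right mult_ac)
  qed
  also have "\<dots> = (\<Sum>k\<in>?N. \<Sum>g | g \<in> B \<and> hstrip k g.
      b ^ (psize f - psize k) * (a ^ (psize g - psize k) * gf w g))"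
    by (rule sum.swap_restrict[symmetric]) fact+
  also have "\<dots> = gf (Down b # Up a # w) f"
    by (auto simp: sum_distrib_left L_def[symmetric] intro!: sum.cong)
       (auto simp: next_profiles_def B_def)
  finally show ?thesis .
qed

lemma gf_move_Down:
  assumes "f \<in> profiles"
  shows "gf (map Up as @ Down b # w) f = (\<Prod>a\<leftarrow>as. 1 + a * b) * gf (Down b # map Up as @ w) f"
  using assms
proof (induction as arbitrary: f)
  case (Cons a as)
  let ?n = "length (map Up as @ Down b # w)"
  have "gf (map Up (a # as) @ Down b # w) f =
      (\<Sum>g\<in>next_profiles (Up a) ?n f. step_weight (Up a) f g *
        ((\<Prod>a\<leftarrow>as. 1 + a * b) * gf (Down b # map Up as @ w) g))"
    unfolding list.map append_Cons gf.simps(2)[of "Up a"]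
    by (intro sum.cong refl arg_cong2[of _ _ _ _ times] Cons.IH next_profiles_profile) auto
  also have "\<dots> = (\<Prod>a\<leftarrow>as. 1 + a * b) * gf (Up a # Down b # map Up as @ w) f"
    by (simp add: sum_distrib_left mult_ac)
  also have "\<dots> = (\<Prod>a\<leftarrow>a # as. 1 + a * b) * gf (Down b # map Up (a # as) @ w) f"
    by (subst gf_Up_Down[OF Cons.prems]) (simp add: mult_ac)
  finally show ?case .
qed simp

lemma le_vac_imp_eq: "f \<in> profiles \<Longrightarrow> (\<And>y. f y \<le> vac y) \<Longrightarrow> f = vac"
  by (intro ext antisym) (auto intro: profile_ge_vac)

lemma gf_Down_vac: "gf (Down b # w) vac = gf w vac"
proof -
  have "next_profiles (Down b) (length w) vac = {vac}"
    using le_vac_imp_eq by (auto simp: next_profiles_def vstrip_def) (auto simp: vac_def)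
  then show ?thesis by simp
qed

text \<open>Starting from a nonempty partition, adding strips cannot lead to the empty one.\<close>

lemma gf_Ups:
  assumes "f \<in> profiles"
  shows "gf (map Up as) f = of_bool (f = vac)"
  using assms
proof (induction as arbitrary: f)
  case (Cons a as)
  let ?N = "next_profiles (Up a) (length as) f"
  have "gf (map Up (a # as)) f = (\<Sum>g\<in>?N. if g = vac then 1 else 0)"
    by (auto simp: Cons.IH next_profiles_profile intro!: sum.cong)
  also have "\<dots> = (if vac \<in> ?N then 1 else 0)"
    using finite_next_profiles[OF Cons.prems, of "Up a" "length as"] by simp
  also have "vac \<in> ?N \<longleftrightarrow> f = vac"
    using le_vac_imp_eq[OF Cons.prems] by (auto simp: next_profiles_def hstrip_def) (auto simp: vac_def)
  finally show ?case by simp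
qed simp

fun zigzag :: "(nat \<Rightarrow> 'a) \<Rightarrow> (nat \<Rightarrow> 'a) \<Rightarrow> nat \<Rightarrow> nat \<Rightarrow> 'a letter list" where
  "zigzag a b i 0 = []"
| "zigzag a b i (Suc m) = Up (a i) # Down (b i) # zigzag a b (Suc i) m"

text \<open>The generalisation that the induction needs: the removing steps already treated have been moved to the
  front, where they act trivially on the empty partition, so that only their adding steps are left.\<close>

lemma gf_zigzag_aux:
  fixes a b :: "nat \<Rightarrow> 'a :: comm_ring_1"
  shows "gf (map Up (map a [0..<i]) @ zigzag a b i m) vac = (\<Prod>j=i..<i + m. \<Prod>l\<le>j. 1 + a l * b j)"
proof (induction m arbitrary: i)
  case 0
  then show ?case using gf_Ups[of vac "map a [0..<i]"] by simp
next
  case (Suc m)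
  have "gf (map Up (map a [0..<i]) @ zigzag a b i (Suc m)) vac =
      gf (map Up (map a [0..<Suc i]) @ Down (b i) # zigzag a b (Suc i) m) vac"
    by simp
  also have "\<dots> = (\<Prod>c\<leftarrow>map a [0..<Suc i]. 1 + c * b i) *
      gf (map Up (map a [0..<Suc i]) @ zigzag a b (Suc i) m) vac"
    by (simp only: gf_move_Down[OF vac_profile] gf_Down_vac)
  also have "(\<Prod>c\<leftarrow>map a [0..<Suc i]. 1 + c * b i) = (\<Prod>l\<le>i. 1 + a l * b i)"
    by (simp add: prod.distinct_set_conv_list[symmetric] comp_def atLeast0LessThan lessThan_Suc_atMost
        del: upt_Suc)
  also have "gf (map Up (map a [0..<Suc i]) @ zigzag a b (Suc i) m) vac =
      (\<Prod>j=Suc i..<Suc i + m. \<Prod>l\<le>j. 1 + a l * b j)"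
    by (rule Suc.IH)
  finally show ?case by (simp add: prod.atLeast_Suc_lessThan)
qed

lemma gf_zigzag:
  fixes a b :: "nat \<Rightarrow> 'a :: comm_ring_1"
  shows "gf (zigzag a b 0 n) vac = (\<Prod>j<n. \<Prod>l\<le>j. 1 + a l * b j)"
  using gf_zigzag_aux[of a 0 b n] by (simp add: atLeast0LessThan)

lemma length_zigzag [simp]: "length (zigzag a b i m) = 2 * m"
  by (induction m arbitrary: i) auto

lemma nth_zigzag:
  "j < 2 * m \<Longrightarrow> zigzag a b i m ! j = (if even j then Up (a (i + j div 2)) else Down (b (i + j div 2)))"
proof (induction m arbitrary: i j)
  case (Suc m)
  consider "j = 0" | "j = 1" | j' where "j = Suc (Suc j')"
    by (metis One_nat_def not0_implies_Suc)
  then show ?case using Suc by cases auto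
qed simp

text \<open>A description of the sequences without the bounds on the length of the first row, which follow from the fact
  that the sequence ends with the empty partition.\<close>

lemma in_paths_iff:
  assumes "f \<in> profiles"
  shows "l \<in> paths w f \<longleftrightarrow> length l = length w \<and> set l \<subseteq> profiles \<and>
    (\<forall>j<length w. strip_step (w ! j) ((f # l) ! j) (l ! j)) \<and> last (f # l) = vac"
    (is "_ \<longleftrightarrow> ?P w f l")
proof -
  have zero: "f y = 0" if "f \<in> profiles" "?P w f l" "y \<le> - int (length w)" for w f y l
    using that
  proof (induction w arbitrary: f l y)
    case Nil
    then have "f = vac" by auto
    then show ?case using Nil.prems(3) by (simp add: vac_def)
  next
    case (Cons s w)
    then obtain g l' where l: "l = g # l'" by (cases l) auto
    have g: "g \<in> profiles" "?P w g l'" "strip_step s f g"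
      using Cons.prems(2) by (force simp: l)+
    have "f y \<le> 0"
    proof (cases s)
      case (Up a)
      then have "f y \<le> g y" using g(3) by (simp add: hstrip_def)
      then show ?thesis using Cons.IH[OF g(1,2), of y] Cons.prems(3) by simp
    next
      case (Down b)
      then have "f y \<le> g (y + 1)" using g(3) by (simp add: vstrip_def)
      then show ?thesis using Cons.IH[OF g(1,2), of "y + 1"] Cons.prems(3) by simp
    qed
    then show ?case using profile_ge_vac[OF Cons.prems(1), of y] by (simp add: vac_def)
  qed
  show ?thesis using assms
  proof (induction w arbitrary: f l)
    case Nil
    then show ?case by auto
  next
    case (Cons s w)
    show ?case
    proof (cases l)
      case Nil
      then show ?thesis by auto
    next
      case l: (Cons g l')
      have "l \<in> paths (s # w) f \<longleftrightarrow> g \<in> next_profiles s (length w) f \<and> l' \<in> paths w g"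
        by (auto simp: l)
      also have "\<dots> \<longleftrightarrow> g \<in> profiles \<and> strip_step s f g \<and> ?P w g l'"
      proof (cases "g \<in> profiles")
        case True
        then show ?thesis
          using zero[where w = w and f = g and l = l', OF True] Cons.IH[OF True, of l']
          unfolding next_profiles_def by blast
      qed (auto dest: next_profiles_profile)
      also have "\<dots> \<longleftrightarrow> ?P (s # w) f l"
        unfolding l length_Cons All_less_Suc2 by auto
      finally show ?thesis .
    qed
  qed
qed

section \<open>Height functions and their diagonals\<close>

text \<open>A rescaled form of Thurston's height function for domino tilings: the function \<open>4 * h x y - 2 * y\<close>, plus
  \<open>1\<close> at even points, changes by \<open>\<plusminus>1\<close> or \<open>\<plusminus>3\<close> along every lattice edge.\<close>

definition heights :: "nat \<Rightarrow> (int \<Rightarrow> int \<Rightarrow> int) set" where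
  "heights n = {h.
     (\<forall>x y. h x y \<le> h x (y + 1) \<and> h x (y + 1) \<le> h x y + 1) \<and>
     (\<forall>x y. even (x + y + int n) \<longrightarrow> h x y \<le> h (x + 1) y \<and> h (x + 1) y \<le> h x y + 1) \<and>
     (\<forall>x y. odd (x + y + int n) \<longrightarrow> h (x + 1) y \<le> h x y \<and> h x y \<le> h (x + 1) y + 1) \<and>
     (\<forall>x y. \<bar>x\<bar> + \<bar>y\<bar> \<ge> int n \<longrightarrow> h x y = vac y)}"

lemma heightsD:
  assumes "h \<in> heights n"
  shows "h x y \<le> h x (y + 1)" "h x (y + 1) \<le> h x y + 1"
    "even (x + y + int n) \<Longrightarrow> h x y \<le> h (x + 1) y"
    "even (x + y + int n) \<Longrightarrow> h (x + 1) y \<le> h x y + 1"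
    "odd (x + y + int n) \<Longrightarrow> h (x + 1) y \<le> h x y"
    "odd (x + y + int n) \<Longrightarrow> h x y \<le> h (x + 1) y + 1"
    "\<bar>x\<bar> + \<bar>y\<bar> \<ge> int n \<Longrightarrow> h x y = vac y"
  using assms unfolding heights_def by blast+

lemma heights_ge_vac: "h \<in> heights n \<Longrightarrow> vac y \<le> h x y"
  by (rule ge_vac[of "h x" "int n + \<bar>x\<bar>"]) (auto intro: heightsD)

definition diagonal :: "nat \<Rightarrow> (int \<Rightarrow> int \<Rightarrow> int) \<Rightarrow> nat \<Rightarrow> int \<Rightarrow> int" where
  "diagonal n h j = (\<lambda>y. h (int j - int n - y) y)"

text \<open>Two consecutive points of a diagonal, \<open>(X, y)\<close> and \<open>(X - 1, y + 1)\<close>, are opposite corners of a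
  square. One way around the square bounds the difference of the heights from below, the other one from above.\<close>

lemma diagonal_profile:
  assumes h: "h \<in> heights n"
  shows "diagonal n h j \<in> profiles"
proof -
  note D = heightsD[OF h]
  have "diagonal n h j y \<le> diagonal n h j (y + 1) \<and> diagonal n h j (y + 1) \<le> diagonal n h j y + 1" for y
  proof -
    define X where "X = int j - int n - y"
    have "diagonal n h j y = h X y" "diagonal n h j (y + 1) = h (X - 1) (y + 1)"
      by (simp_all add: diagonal_def X_def algebra_simps)
    moreover have "h X y \<le> h (X - 1) (y + 1) \<and> h (X - 1) (y + 1) \<le> h X y + 1"
    proof (cases "even (X + y + int n)")
      case True
      then have p: "odd (X - 1 + y + int n)" "even (X - 1 + (y + 1) + int n)" by presburger+
      show ?thesis
        using D(1,2)[of X y] D(1,2)[of "X - 1" y] D(5,6)[OF p(1)] D(3,4)[OF p(2)] by simp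
    next
      case False
      then have p: "even (X - 1 + y + int n)" "odd (X - 1 + (y + 1) + int n)" by presburger+
      show ?thesis
        using D(1,2)[of X y] D(1,2)[of "X - 1" y] D(3,4)[OF p(1)] D(5,6)[OF p(2)] by simp
    qed
    ultimately show ?thesis by simp
  qed
  moreover have "diagonal n h j y = vac y" if "\<bar>y\<bar> \<ge> int n" for y
    unfolding diagonal_def using that by (intro D(7)) simp
  ultimately show ?thesis unfolding profiles_def by blast
qed

lemma diagonal_ends:
  assumes "h \<in> heights n"
  shows "diagonal n h 0 = vac" "diagonal n h (2 * n) = vac"
  unfolding diagonal_def using heightsD(7)[OF assms] by (auto intro!: ext)

lemma diagonal_strips:
  assumes h: "h \<in> heights n"
  shows "even j \<Longrightarrow> hstrip (diagonal n h j) (diagonal n h (Suc j))"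
    and "odd j \<Longrightarrow> vstrip (diagonal n h (Suc j)) (diagonal n h j)"
proof -
  note D = heightsD[OF h]
  have e: "diagonal n h j y = h (int j - int n - y) y"
      "diagonal n h j (y - 1) = h (int j - int n - y + 1) (y - 1)"
      "diagonal n h (Suc j) y = h (int j - int n - y + 1) y"
      "diagonal n h (Suc j) (y + 1) = h (int j - int n - y) (y + 1)" for y
    by (simp_all add: diagonal_def algebra_simps)
  show "hstrip (diagonal n h j) (diagonal n h (Suc j))" if "even j"
    unfolding hstrip_def
  proof
    fix y
    have "even (int j - int n - y + y + int n)" using that by simp
    from D(3)[OF this] D(2)[of "int j - int n - y + 1" "y - 1"]
    show "diagonal n h j y \<le> diagonal n h (Suc j) y \<and>
      diagonal n h (Suc j) y \<le> diagonal n h j (y - 1) + 1"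
      by (simp add: e(1)[of y] e(2)[of y] e(3)[of y])
  qed
  show "vstrip (diagonal n h (Suc j)) (diagonal n h j)" if "odd j"
    unfolding vstrip_def
  proof
    fix y
    have "odd (int j - int n - y + y + int n)" using that by simp
    from D(5)[OF this] D(1)[of "int j - int n - y" "y"]
    show "diagonal n h (Suc j) y \<le> diagonal n h j y \<and>
      diagonal n h j y \<le> diagonal n h (Suc j) (y + 1)"
      by (simp add: e(1)[of y] e(3)[of y] e(4)[of y])
  qed
qed

definition path_of :: "nat \<Rightarrow> (int \<Rightarrow> int \<Rightarrow> int) \<Rightarrow> (int \<Rightarrow> int) list" where
  "path_of n h = map (diagonal n h) [1..<2 * n + 1]"

definition height_of_path :: "nat \<Rightarrow> (int \<Rightarrow> int) list \<Rightarrow> int \<Rightarrow> int \<Rightarrow> int" where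
  "height_of_path n l x y =
     (if 0 \<le> x + y + int n \<and> x + y + int n \<le> 2 * int n
      then ((vac # l) ! nat (x + y + int n)) y else vac y)"

lemma length_path_of [simp]: "length (path_of n h) = 2 * n"
  by (simp add: path_of_def)

lemma nth_path_of: "j < 2 * n \<Longrightarrow> path_of n h ! j = diagonal n h (Suc j)"
  by (simp add: path_of_def del: upt_Suc)

lemma nth_vac_path_of:
  assumes "h \<in> heights n" "j \<le> 2 * n"
  shows "(vac # path_of n h) ! j = diagonal n h j"
  using assms by (cases j) (simp_all add: nth_path_of diagonal_ends)

lemma path_of_in_paths:
  assumes h: "h \<in> heights n"
  shows "path_of n h \<in> paths (zigzag a b 0 n) vac"
  unfolding in_paths_iff[OF vac_profile] length_zigzag
proof (intro conjI allI impI)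
  show "set (path_of n h) \<subseteq> profiles"
    using diagonal_profile[OF h] by (auto simp: path_of_def)
  show "strip_step (zigzag a b 0 n ! j) ((vac # path_of n h) ! j) (path_of n h ! j)" if "j < 2 * n" for j
    using that diagonal_strips[OF h]
    by (auto simp: nth_zigzag nth_path_of nth_vac_path_of[OF h] simp del: nth_Cons_Suc)
  show "last (vac # path_of n h) = vac"
    using nth_vac_path_of[OF h, of "2 * n"] diagonal_ends[OF h]
    by (subst last_conv_nth) (simp_all only: length_Cons length_path_of diff_Suc_1 list.distinct not_False_eq_True)
qed simp

lemma height_of_path_of:
  assumes h: "h \<in> heights n"
  shows "height_of_path n (path_of n h) = h"
proof (intro ext)
  fix x y
  show "height_of_path n (path_of n h) x y = h x y"
  proof (cases "0 \<le> x + y + int n \<and> x + y + int n \<le> 2 * int n")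
    case True
    then have "(vac # path_of n h) ! nat (x + y + int n) = diagonal n h (nat (x + y + int n))"
      by (intro nth_vac_path_of h) auto
    then show ?thesis using True by (simp add: height_of_path_def diagonal_def)
  next
    case False
    then have "\<bar>x\<bar> + \<bar>y\<bar> \<ge> int n" by auto
    from heightsD(7)[OF h this] show ?thesis using False by (auto simp: height_of_path_def)
  qed
qed

lemma path_of_height_of_path:
  assumes "length l = 2 * n"
  shows "path_of n (height_of_path n l) = l"
  using assms
  by (intro nth_equalityI) (auto simp: nth_path_of diagonal_def height_of_path_def simp del: of_nat_Suc)

text \<open>That the height function is \<open>vac\<close> for \<open>\<bar>x\<bar> + \<bar>y\<bar> \<ge> n\<close> expresses that the \<open>j\<close>-th
  partition has at most as many rows as there were adding steps before it (\<open>top\<close> below), and at most as many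
  columns as there are removing steps after it (\<open>bot\<close> below).\<close>

lemma height_of_path_heights:
  assumes l: "l \<in> paths (zigzag a b 0 n) vac"
  shows "height_of_path n l \<in> heights n"
proof -
  define F where "F j = (vac # l) ! j" for j
  have len: "length l = 2 * n" and lp: "set l \<subseteq> profiles"
    and step: "\<And>j. j < 2 * n \<Longrightarrow> strip_step (zigzag a b 0 n ! j) (F j) (F (Suc j))"
    and last: "last (vac # l) = vac"
    using l unfolding in_paths_iff[OF vac_profile] by (auto simp: F_def)
  have F: "F j \<in> profiles" if "j \<le> 2 * n" for j
    using that lp len by (cases j) (auto simp: F_def)
  have F0: "F 0 = vac" by (simp add: F_def)
  have F2n: "F (2 * n) = vac" using last last_conv_nth[of "vac # l"]
    by (simp only: F_def len length_Cons diff_Suc_1 list.distinct not_False_eq_True)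
  have hs: "F j y \<le> F (Suc j) y" "F (Suc j) y \<le> F j (y - 1) + 1" if "even j" "j < 2 * n" for j y
    using step[OF that(2)] that by (auto simp: nth_zigzag hstrip_def)
  have vs: "F (Suc j) y \<le> F j y" "F j y \<le> F (Suc j) (y + 1)" if "odd j" "j < 2 * n" for j y
    using step[OF that(2)] that by (auto simp: nth_zigzag vstrip_def)
  \<comment> \<open>At most \<open>j / 2\<close> rows, rounded up.\<close>
  have top: "F j y \<le> y" if "j \<le> 2 * n" "2 * y \<ge> int j" for j y
    using that
  proof (induction j arbitrary: y)
    case 0
    then show ?case by (simp add: F0 vac_def)
  next
    case (Suc j)
    show ?case
    proof (cases "even j")
      case True
      then have "2 * (y - 1) \<ge> int j" using Suc.prems by presburger
      then have "F j (y - 1) \<le> y - 1" using Suc.IH[of "y - 1"] Suc.prems by simp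
      then show ?thesis using hs(2)[of j y] True Suc.prems by auto
    next
      case False
      then show ?thesis using vs(1)[of j y] Suc.IH[of y] Suc.prems by auto
    qed
  qed
  \<comment> \<open>At most \<open>(2 * n - j) / 2\<close> columns, rounded up.\<close>
  have bot: "F j y \<le> 0" if "j \<le> 2 * n" "2 * int n - int j \<le> - 2 * y" for j y
    using that
  proof (induction j arbitrary: y rule: inc_induct)
    case base
    then show ?case by (simp add: F2n vac_def)
  next
    case (step j)
    show ?case
    proof (cases "even j")
      case True
      then show ?thesis using hs(1)[of j y] step.IH[of y] step.hyps step.prems by auto
    next
      case False
      then have "2 * int n - int (Suc j) \<le> - 2 * (y + 1)" using step.prems by presburger
      from step.IH[OF this] show ?thesis using vs(2)[of j y] False step.hyps by auto
    qed
  qed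
  let ?h = "height_of_path n l"
  have hF: "?h x y = F (nat (x + y + int n)) y" if "0 \<le> x + y + int n" "x + y + int n \<le> 2 * int n" for x y
    using that by (simp add: height_of_path_def F_def)
  have hvac: "?h x y = vac y" if "x + y + int n \<le> 0 \<or> 2 * int n \<le> x + y + int n" for x y
  proof -
    consider "x + y + int n = 0" | "x + y + int n = 2 * int n"
      | "\<not> (0 \<le> x + y + int n \<and> x + y + int n \<le> 2 * int n)" using \<open>_ \<or> _\<close> by linarith
    then show ?thesis
    proof cases
      case 1
      then show ?thesis using hF[of x y] by (simp add: F0)
    next
      case 2
      then have "nat (x + y + int n) = 2 * n" by simp
      then show ?thesis using hF[of x y] 2 by (simp add: F2n)
    qed (auto simp: height_of_path_def)
  qed
  have vac_step: "vac y \<le> vac (y + 1)" "vac (y + 1) \<le> vac y + 1" for y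
    by (auto simp: vac_def)
  have horiz: "?h x y \<le> ?h x (y + 1) \<and> ?h x (y + 1) \<le> ?h x y + 1 \<and>
      (even (x + y + int n) \<longrightarrow> ?h x y \<le> ?h (x + 1) y \<and> ?h (x + 1) y \<le> ?h x y + 1) \<and>
      (odd (x + y + int n) \<longrightarrow> ?h (x + 1) y \<le> ?h x y \<and> ?h x y \<le> ?h (x + 1) y + 1)" for x y
  proof (cases "0 \<le> x + y + int n \<and> x + y + int n < 2 * int n")
    case True
    define j where "j = nat (x + y + int n)"
    have j: "j < 2 * n" "x + y + int n = int j" using True by (auto simp: j_def)
    have e: "?h x y = F j y" "?h x (y + 1) = F (Suc j) (y + 1)" "?h (x + 1) y = F (Suc j) y"
      using True hF[of x y] hF[of x "y + 1"] hF[of "x + 1" y]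
      by (auto simp: j_def nat_add_distrib algebra_simps)
    show ?thesis unfolding e j(2)
      using hs[of j y] hs[of j "y + 1"] vs[of j y] vs[of j "y + 1"] j(1)
        profileD[OF F[of j], of y] profileD[OF F[of "Suc j"], of y]
      by (cases "even j") auto
  next
    case False
    then have "?h x y = vac y" "?h x (y + 1) = vac (y + 1)" "?h (x + 1) y = vac y"
      by (intro hvac; linarith)+
    then show ?thesis using vac_step[of y] by simp
  qed
  have "?h x y = vac y" if "\<bar>x\<bar> + \<bar>y\<bar> \<ge> int n" for x y
  proof (cases "0 \<le> x + y + int n \<and> x + y + int n \<le> 2 * int n")
    case True
    define j where "j = nat (x + y + int n)"
    have j: "j \<le> 2 * n" "x + y + int n = int j" using True by (auto simp: j_def)
    have "(x + y + int n \<le> 0 \<or> 2 * int n \<le> x + y + int n) \<or>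
        (y - x \<ge> int n \<and> y \<ge> 0) \<or> (x - y \<ge> int n \<and> y \<le> 0)"
      using that by linarith
    then consider "x + y + int n \<le> 0 \<or> 2 * int n \<le> x + y + int n" | "y - x \<ge> int n" "y \<ge> 0" | "x - y \<ge> int n" "y \<le> 0"
      by blast
    then show ?thesis
    proof cases
      case 2
      then have "F j y \<le> y" using j by (intro top) auto
      then show ?thesis using profile_ge_vac[OF F[OF j(1)], of y] hF[of x y] True 2
        by (simp add: j_def vac_def)
    next
      case 3
      then have "F j y \<le> 0" using j by (intro bot) auto
      then show ?thesis using profile_ge_vac[OF F[OF j(1)], of y] hF[of x y] True 3
        by (simp add: j_def vac_def)
    qed (rule hvac)
  qed (auto intro: hvac)
  with horiz show ?thesis unfolding heights_def by blast
qed

lemma bij_betw_path_of: "bij_betw (path_of n) (heights n) (paths (zigzag a b 0 n) vac)"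
proof (rule bij_betwI[where g = "height_of_path n"])
  show "path_of n (height_of_path n l) = l" if "l \<in> paths (zigzag a b 0 n) vac" for l
    using that by (intro path_of_height_of_path) (simp add: in_paths_iff)
qed (auto simp: path_of_in_paths height_of_path_heights height_of_path_of)

lemma path_weight_eq_prod:
  "length l = length w \<Longrightarrow>
    path_weight w f l = (\<Prod>j<length w. step_weight (w ! j) ((f # l) ! j) (l ! j))"
proof (induction w arbitrary: f l)
  case (Cons s w)
  then obtain g l' where "l = g # l'" by (cases l) auto
  then show ?case using Cons by (simp add: prod.lessThan_Suc_shift del: prod.lessThan_Suc)
qed simp

lemma prod_pairs: "(\<Prod>j<2 * m. f j) = (\<Prod>i<m. f (2 * i) * f (2 * i + 1 :: nat) :: 'a :: comm_monoid_mult)"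
  by (induction m) (simp_all add: mult_ac)

lemma sum_pairs: "(\<Sum>j<2 * m. f j) = (\<Sum>i<m. f (2 * i) + f (2 * i + 1 :: nat) :: 'a :: comm_monoid_add)"
  by (induction m) (simp_all add: add_ac)

text \<open>Summation by parts: with these weights a box that belongs to the \<open>j\<close>-th partition contributes exactly
  one \<open>q\<close>, and the factor \<open>q ^ (2 * m * s (2 * m))\<close> is the boundary term.\<close>

lemma zigzag_weight:
  fixes q x :: "'a :: field" and s :: "nat \<Rightarrow> nat"
  assumes q: "q \<noteq> 0" and "s 0 = 0"
    and "\<And>i. s (2 * i) \<le> s (2 * i + 1)" "\<And>i. s (2 * i + 2) \<le> s (2 * i + 1)"
  shows "(\<Prod>i<m. (inverse q ^ (2 * i)) ^ (s (2 * i + 1) - s (2 * i)) *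
            (x * q ^ (2 * i + 1)) ^ (s (2 * i + 1) - s (2 * i + 2))) * q ^ (2 * m * s (2 * m)) =
         x ^ (\<Sum>i<m. s (2 * i + 1) - s (2 * i + 2)) * q ^ (\<Sum>j\<le>2 * m. s j)"
proof (induction m)
  case 0
  then show ?case using assms by simp
next
  case (Suc m)
  define u v w where "u = s (2 * m)" "v = s (2 * m + 1)" "w = s (2 * m + 2)"
  obtain d e where d: "v = u + d" and e: "v = w + e"
    using assms(3,4)[of m] by (metis u_v_w_def le_iff_add)
  define P where "P = (\<Prod>i<m. (inverse q ^ (2 * i)) ^ (s (2 * i + 1) - s (2 * i)) *
            (x * q ^ (2 * i + 1)) ^ (s (2 * i + 1) - s (2 * i + 2)))"
  define X where "X = x ^ (\<Sum>i<m. s (2 * i + 1) - s (2 * i + 2))"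
  define S where "S = (\<Sum>j\<le>2 * m. s j)"
  have IH: "P * q ^ (2 * m * u) = X * q ^ S"
    using Suc unfolding P_def X_def S_def u_v_w_def by simp
  have exp: "(2 * m + 1) * e + (2 * m + 2) * w = 2 * m * u + 2 * m * d + (v + w)"
  proof -
    have "(2 * m + 1) * e + (2 * m + 2) * w = 2 * m * (w + e) + (w + e) + w"
      by (simp add: algebra_simps)
    also have "\<dots> = 2 * m * (u + d) + v + w" using d e by simp
    finally show ?thesis by (simp add: algebra_simps)
  qed
  have "P * ((inverse q ^ (2 * m)) ^ d * (x * q ^ (2 * m + 1)) ^ e) * q ^ ((2 * m + 2) * w) =
      P * (inverse q ^ (2 * m * d)) * x ^ e * (q ^ ((2 * m + 1) * e) * q ^ ((2 * m + 2) * w))"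
    by (simp only: power_mult[symmetric] power_mult_distrib mult_ac)
  also have "q ^ ((2 * m + 1) * e) * q ^ ((2 * m + 2) * w) = q ^ ((2 * m + 1) * e + (2 * m + 2) * w)"
    by (rule power_add[symmetric])
  also have "P * (inverse q ^ (2 * m * d)) * x ^ e * q ^ ((2 * m + 1) * e + (2 * m + 2) * w) =
      (P * q ^ (2 * m * u)) * (inverse q * q) ^ (2 * m * d) * x ^ e * q ^ (v + w)"
    unfolding exp by (simp only: power_mult[symmetric] power_mult_distrib power_add mult_ac)
  also have "\<dots> = X * x ^ e * q ^ (S + v + w)"
    unfolding IH using q by (simp add: power_add)
  finally have "P * ((inverse q ^ (2 * m)) ^ d * (x * q ^ (2 * m + 1)) ^ e) * q ^ ((2 * m + 2) * w) =
      X * x ^ e * q ^ (S + v + w)" .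
  moreover have "v - u = d" "v - w = e" using d e by auto
  moreover have "(\<Sum>j\<le>2 * Suc m. s j) = S + v + w"
    by (simp add: S_def u_v_w_def)
  moreover have "x ^ (\<Sum>i<Suc m. s (2 * i + 1) - s (2 * i + 2)) = X * x ^ (v - w)"
    by (simp add: X_def u_v_w_def power_add)
  moreover have "(2 * Suc m * s (2 * Suc m)) = (2 * m + 2) * w"
    by (simp add: u_v_w_def)
  ultimately show ?case by (simp add: P_def u_v_w_def)
qed

definition excess :: "nat \<Rightarrow> (int \<Rightarrow> int \<Rightarrow> int) \<Rightarrow> nat" where
  "excess n h = (\<Sum>y\<in>{-int n..int n}. \<Sum>x\<in>{-int n..int n}. nat (h x y - vac y))"

definition alt_excess :: "nat \<Rightarrow> (int \<Rightarrow> int \<Rightarrow> int) \<Rightarrow> int" where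
  "alt_excess n h = (\<Sum>y\<in>{-int n..int n}. \<Sum>x\<in>{-int n..int n}.
     (if odd (x + y + int n) then 1 else -1) * (h x y - vac y))"

text \<open>The ranges of \<open>x\<close> on the two sides differ, but only by points at which \<open>h\<close> has no excess.\<close>

lemma sum_by_diagonals:
  assumes h: "h \<in> heights n"
  shows "(\<Sum>y\<in>{-int n..int n}. \<Sum>x\<in>{-int n..int n}. F (x + y + int n) * (h x y - vac y)) =
         (\<Sum>j\<le>2 * n. F (int j) * int (psize (diagonal n h j)))"
proof -
  have size: "int (psize (diagonal n h j)) = (\<Sum>y\<in>{-int n..int n}. diagonal n h j y - vac y)" for j
    using heights_ge_vac[OF h] heightsD(7)[OF h]
    by (intro psize_eq_int_sum) (auto simp: diagonal_def)
  have row: "(\<Sum>j\<le>2 * n. F (int j) * (diagonal n h j y - vac y)) =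
      (\<Sum>x\<in>{-int n..int n}. F (x + y + int n) * (h x y - vac y))" for y
  proof -
    have "(\<Sum>j\<le>2 * n. F (int j) * (diagonal n h j y - vac y)) =
        (\<Sum>x\<in>{-int n - y..int n - y}. F (x + y + int n) * (h x y - vac y))"
      by (rule sum.reindex_bij_witness[of _ "\<lambda>x. nat (x + y + int n)" "\<lambda>j. int j - int n - y"])
         (auto simp: diagonal_def)
    also have "\<dots> = (\<Sum>x\<in>{-int n - \<bar>y\<bar>..int n + \<bar>y\<bar>}. F (x + y + int n) * (h x y - vac y))"
      using heightsD(7)[OF h] by (intro sum.mono_neutral_left) auto
    also have "\<dots> = (\<Sum>x\<in>{-int n..int n}. F (x + y + int n) * (h x y - vac y))"
      using heightsD(7)[OF h] by (intro sum.mono_neutral_right) auto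
    finally show ?thesis .
  qed
  have "(\<Sum>j\<le>2 * n. F (int j) * int (psize (diagonal n h j))) =
      (\<Sum>y\<in>{-int n..int n}. \<Sum>j\<le>2 * n. F (int j) * (diagonal n h j y - vac y))"
    unfolding size sum_distrib_left by (rule sum.swap)
  then show ?thesis by (simp add: row)
qed

lemma excess_eq:
  assumes "h \<in> heights n"
  shows "excess n h = (\<Sum>j\<le>2 * n. psize (diagonal n h j))"
proof -
  have "int (excess n h) = int (\<Sum>j\<le>2 * n. psize (diagonal n h j))"
    using sum_by_diagonals[OF assms, of "\<lambda>_. 1"] heights_ge_vac[OF assms] by (simp add: excess_def)
  then show ?thesis by linarith
qed

lemma psize_mono:
  assumes f: "f \<in> profiles" and g: "g \<in> profiles" and le: "\<And>y. f y \<le> g y"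
  shows "psize f \<le> psize g"
proof -
  obtain m where m: "\<And>y. \<bar>y\<bar> \<ge> m \<Longrightarrow> f y = vac y" using profile_vac[OF f] by blast
  obtain k where k: "\<And>y. \<bar>y\<bar> \<ge> k \<Longrightarrow> g y = vac y" using profile_vac[OF g] by blast
  define M where "M = max \<bar>m\<bar> \<bar>k\<bar>"
  have "f y = vac y" "g y = vac y" if "y \<notin> {-M..M}" for y
    using that by (auto intro!: m k simp: M_def)
  then have "psize f = (\<Sum>y\<in>{-M..M}. nat (f y - vac y))" "psize g = (\<Sum>y\<in>{-M..M}. nat (g y - vac y))"
    by (intro psize_eq_sum; simp)+
  then show ?thesis using le by (simp add: sum_mono nat_mono)
qed

lemma psize_diagonal_steps:
  assumes h: "h \<in> heights n"
  shows "psize (diagonal n h (2 * i)) \<le> psize (diagonal n h (2 * i + 1))"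
    and "psize (diagonal n h (2 * i + 2)) \<le> psize (diagonal n h (2 * i + 1))"
  using diagonal_strips[OF h, of "2 * i"] diagonal_strips[OF h, of "2 * i + 1"] diagonal_profile[OF h]
  by (auto intro!: psize_mono simp: hstrip_def vstrip_def)

lemma alt_excess_eq:
  assumes h: "h \<in> heights n"
  shows "alt_excess n h = int (\<Sum>i<n. psize (diagonal n h (2 * i + 1)) - psize (diagonal n h (2 * i + 2)))"
proof -
  define s where "s j = int (psize (diagonal n h j))" for j
  have "alt_excess n h = (\<Sum>j\<le>2 * n. (if odd j then 1 else -1) * s j)"
    using sum_by_diagonals[OF h, of "\<lambda>j. if odd j then 1 else -1"] by (simp add: alt_excess_def s_def)
  also have "\<dots> = - s 0 + (\<Sum>j<2 * n. (if odd (Suc j) then 1 else -1) * s (Suc j))"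
    unfolding lessThan_Suc_atMost[symmetric] by (subst sum.lessThan_Suc_shift) simp
  also have "\<dots> = (\<Sum>i<n. s (2 * i + 1) - s (2 * i + 2))"
    unfolding sum_pairs by (simp add: s_def diagonal_ends[OF h])
  also have "\<dots> = int (\<Sum>i<n. psize (diagonal n h (2 * i + 1)) - psize (diagonal n h (2 * i + 2)))"
    using psize_diagonal_steps(2)[OF h] by (simp add: s_def of_nat_diff)
  finally show ?thesis .
qed

lemma path_weight_path_of:
  fixes q x :: "'a :: field"
  assumes q: "q \<noteq> 0" and h: "h \<in> heights n"
  shows "path_weight (zigzag (\<lambda>i. inverse q ^ (2 * i)) (\<lambda>i. x * q ^ (2 * i + 1)) 0 n) vac (path_of n h) =
    x ^ nat (alt_excess n h) * q ^ excess n h"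
proof -
  define s where "s j = psize (diagonal n h j)" for j
  have "path_weight (zigzag (\<lambda>i. inverse q ^ (2 * i)) (\<lambda>i. x * q ^ (2 * i + 1)) 0 n) vac (path_of n h) =
    (\<Prod>i<n. (inverse q ^ (2 * i)) ^ (s (2 * i + 1) - s (2 * i)) *
            (x * q ^ (2 * i + 1)) ^ (s (2 * i + 1) - s (2 * i + 2)))"
    by (subst path_weight_eq_prod)
       (auto simp: prod_pairs nth_zigzag nth_path_of nth_vac_path_of[OF h] s_def
         simp del: nth_Cons_Suc intro!: prod.cong)
  also have "\<dots> = \<dots> * q ^ (2 * n * s (2 * n))"
    by (simp add: s_def diagonal_ends[OF h])
  also have "\<dots> = x ^ nat (alt_excess n h) * q ^ excess n h"
    unfolding alt_excess_eq[OF h] excess_eq[OF h] nat_int s_def[symmetric]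
    using q psize_diagonal_steps[OF h]
    by (intro zigzag_weight) (auto simp: s_def diagonal_ends[OF h])
  finally show ?thesis .
qed

lemma prod_triangle:
  "(\<Prod>j<n. \<Prod>k\<le>j. c k) = (\<Prod>k<n. c k ^ (n - k) :: 'a :: comm_monoid_mult)"
proof (induction n)
  case (Suc n)
  have "(\<Prod>k<n. c k ^ (Suc n - k)) = (\<Prod>k<n. c k ^ (n - k)) * (\<Prod>k<n. c k)"
    unfolding prod.distrib[symmetric] by (intro prod.cong) (auto simp: Suc_diff_le mult.commute)
  then show ?case using Suc by (simp add: lessThan_Suc_atMost[symmetric] mult_ac)
qed simp

text \<open>\<open>gf_zigzag\<close> with \<open>a i * b j = x * q ^ (2 * (j - i) + 1)\<close>.\<close>

lemma heights_gf:
  fixes q x :: "'a :: field"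
  assumes q: "q \<noteq> 0"
  shows "(\<Sum>h\<in>heights n. x ^ nat (alt_excess n h) * q ^ excess n h) =
         (\<Prod>k<n. (1 + x * q ^ (2 * k + 1)) ^ (n - k))"
proof -
  let ?a = "\<lambda>i. inverse q ^ (2 * i)" and ?b = "\<lambda>i. x * q ^ (2 * i + 1)"
  have "(\<Sum>h\<in>heights n. x ^ nat (alt_excess n h) * q ^ excess n h) =
      (\<Sum>h\<in>heights n. path_weight (zigzag ?a ?b 0 n) vac (path_of n h))"
    by (intro sum.cong refl path_weight_path_of[OF q, symmetric])
  also have "\<dots> = gf (zigzag ?a ?b 0 n) vac"
    unfolding gf_eq_sum_paths[OF vac_profile] by (rule sum.reindex_bij_betw[OF bij_betw_path_of])
  also have "\<dots> = (\<Prod>j<n. \<Prod>l\<le>j. 1 + ?a l * ?b j)"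
    by (rule gf_zigzag)
  also have "\<dots> = (\<Prod>j<n. \<Prod>k\<le>j. 1 + x * q ^ (2 * k + 1))"
  proof (rule prod.cong[OF refl])
    fix j
    have "(\<Prod>l\<le>j. 1 + ?a l * ?b j) = (\<Prod>l\<le>j. 1 + x * q ^ (2 * (j - l) + 1))"
    proof (rule prod.cong[OF refl])
      fix l assume "l \<in> {..j}"
      then have e: "2 * l + (2 * (j - l) + 1) = 2 * j + 1" by simp
      have "q ^ (2 * j + 1) = q ^ (2 * l) * q ^ (2 * (j - l) + 1)"
        using power_add[of q "2 * l" "2 * (j - l) + 1"] unfolding e .
      then have "?a l * ?b j = (inverse q * q) ^ (2 * l) * (x * q ^ (2 * (j - l) + 1))"
        by (simp only: power_mult_distrib mult_ac)
      then show "1 + ?a l * ?b j = 1 + x * q ^ (2 * (j - l) + 1)"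
        using q by simp
    qed
    also have "\<dots> = (\<Prod>k\<le>j. 1 + x * q ^ (2 * k + 1))"
      by (rule prod.reindex_bij_witness[of _ "\<lambda>k. j - k" "\<lambda>k. j - k"]) auto
    finally show "(\<Prod>l\<le>j. 1 + ?a l * ?b j) = (\<Prod>k\<le>j. 1 + x * q ^ (2 * k + 1))" .
  qed
  finally show ?thesis by (simp add: prod_triangle)
qed

section \<open>Tilings and height functions\<close>

definition cell_center :: "int \<Rightarrow> int \<Rightarrow> real \<times> real" where
  "cell_center a b = (real_of_int a + 1 / 2, real_of_int b + 1 / 2)"

text \<open>The square with lower left corner \<open>(a, b)\<close> belongs to the Aztec diamond; \<open>a + b + 1\<close> and
  \<open>a - b\<close> are the coordinates of its centre with respect to the diagonal axes.\<close>

definition in_aztec :: "nat \<Rightarrow> int \<Rightarrow> int \<Rightarrow> bool" where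
  "in_aztec n a b \<longleftrightarrow> \<bar>a + b + 1\<bar> \<le> int n \<and> \<bar>a - b\<bar> \<le> int n"

lemma real_of_int_le_half:
  "real_of_int a \<le> real_of_int c + 1 / 2 \<longleftrightarrow> a \<le> c"
  "real_of_int c + 1 / 2 \<le> real_of_int a \<longleftrightarrow> c < a"
  "real_of_int c + 1 / 2 \<le> real_of_int a + 1 \<longleftrightarrow> c \<le> a"
  "real_of_int c + 1 / 2 \<le> real_of_int a + 2 \<longleftrightarrow> c \<le> a + 1"
  by linarith+

lemma center_in_square: "cell_center c d \<in> lattice_square a b \<longleftrightarrow> c = a \<and> d = b"
  by (auto simp: cell_center_def lattice_square_def real_of_int_le_half)

lemma center_in_hdomino: "cell_center c d \<in> hdomino a b \<longleftrightarrow> (c = a \<or> c = a + 1) \<and> d = b"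
  by (auto simp: cell_center_def hdomino_def real_of_int_le_half)

lemma center_in_vdomino: "cell_center c d \<in> vdomino a b \<longleftrightarrow> c = a \<and> (d = b \<or> d = b + 1)"
  by (auto simp: cell_center_def vdomino_def real_of_int_le_half)

lemma hdomino_eq_iff [simp]: "hdomino a b = hdomino c d \<longleftrightarrow> a = c \<and> b = d"
proof
  assume e: "hdomino a b = hdomino c d"
  show "a = c \<and> b = d"
  proof -
    have "cell_center a b \<in> hdomino c d" "cell_center (a + 1) b \<in> hdomino c d"
      unfolding e[symmetric] by (simp_all add: center_in_hdomino)
    then show ?thesis by (auto simp: center_in_hdomino)
  qed
qed simp

lemma vdomino_eq_iff [simp]: "vdomino a b = vdomino c d \<longleftrightarrow> a = c \<and> b = d"
proof
  assume e: "vdomino a b = vdomino c d"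
  show "a = c \<and> b = d"
  proof -
    have "cell_center a b \<in> vdomino c d" "cell_center a (b + 1) \<in> vdomino c d"
      unfolding e[symmetric] by (simp_all add: center_in_vdomino)
    then show ?thesis by (auto simp: center_in_vdomino)
  qed
qed simp

lemma hdomino_neq_vdomino [simp]: "hdomino a b \<noteq> vdomino c d" "vdomino c d \<noteq> hdomino a b"
proof -
  show "hdomino a b \<noteq> vdomino c d"
  proof
    assume e: "hdomino a b = vdomino c d"
    have "cell_center a b \<in> vdomino c d" "cell_center (a + 1) b \<in> vdomino c d"
      unfolding e[symmetric] by (simp_all add: center_in_hdomino)
    then show False by (simp add: center_in_vdomino)
  qed
  then show "vdomino c d \<noteq> hdomino a b" by metis
qed

lemma dominoE:
  assumes "domino D"
  obtains a b where "D = hdomino a b" | a b where "D = vdomino a b"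
  using assms by (auto simp: domino_def horizontal_domino_def vertical_domino_def)

lemma domino_simps [simp]:
  "domino (hdomino a b)" "domino (vdomino a b)"
  "horizontal_domino (hdomino a b)" "\<not> horizontal_domino (vdomino a b)"
  "vertical_domino (vdomino a b)" "\<not> vertical_domino (hdomino a b)"
  by (auto simp: domino_def horizontal_domino_def vertical_domino_def)

lemma interior_hdomino:
  "interior (hdomino a b) = {real_of_int a<..<real_of_int a + 2} \<times> {real_of_int b<..<real_of_int b + 1}"
  by (simp add: hdomino_def interior_Times interior_atLeastAtMost_real)

lemma interior_vdomino:
  "interior (vdomino a b) = {real_of_int a<..<real_of_int a + 1} \<times> {real_of_int b<..<real_of_int b + 2}"
  by (simp add: vdomino_def interior_Times interior_atLeastAtMost_real)

lemma center_in_interior: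
  assumes "domino D" "cell_center c d \<in> D"
  shows "cell_center c d \<in> interior D"
  using assms(1)
proof (cases rule: dominoE)
  case (1 a b)
  then have "(c = a \<or> c = a + 1) \<and> d = b" using assms(2) by (simp add: center_in_hdomino)
  then show ?thesis using 1 by (auto simp: interior_hdomino cell_center_def)
next
  case (2 a b)
  then have "c = a \<and> (d = b \<or> d = b + 1)" using assms(2) by (simp add: center_in_vdomino)
  then show ?thesis using 2 by (auto simp: interior_vdomino cell_center_def)
qed

lemma center_of_interior_point:
  assumes "domino D" "(x, y) \<in> interior D"
  shows "cell_center \<lfloor>x\<rfloor> \<lfloor>y\<rfloor> \<in> D"
  using assms(1)
proof (cases rule: dominoE)
  case (1 a b)
  then have "real_of_int a < x" "x < real_of_int a + 2" "real_of_int b < y" "y < real_of_int b + 1"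
    using assms(2) by (auto simp: interior_hdomino)
  then have "(\<lfloor>x\<rfloor> = a \<or> \<lfloor>x\<rfloor> = a + 1) \<and> \<lfloor>y\<rfloor> = b" by linarith
  then show ?thesis using 1 by (simp add: center_in_hdomino)
next
  case (2 a b)
  then have "real_of_int a < x" "x < real_of_int a + 1" "real_of_int b < y" "y < real_of_int b + 2"
    using assms(2) by (auto simp: interior_vdomino)
  then have "\<lfloor>x\<rfloor> = a \<and> (\<lfloor>y\<rfloor> = b \<or> \<lfloor>y\<rfloor> = b + 1)" by linarith
  then show ?thesis using 2 by (simp add: center_in_vdomino)
qed

lemma hdomino_eq_squares: "hdomino a b = lattice_square a b \<union> lattice_square (a + 1) b"
  by (auto simp: hdomino_def lattice_square_def)

lemma vdomino_eq_squares: "vdomino a b = lattice_square a b \<union> lattice_square a (b + 1)"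
  by (auto simp: vdomino_def lattice_square_def)

lemma square_subset_domino:
  assumes "domino D" "cell_center a b \<in> D"
  shows "lattice_square a b \<subseteq> D"
  using assms
  by (elim dominoE)
     (auto simp: center_in_square hdomino_eq_squares vdomino_eq_squares)

lemma domino_point_square:
  assumes "domino D" "p \<in> D"
  obtains a b where "p \<in> lattice_square a b" "cell_center a b \<in> D"
  using assms
  by (elim dominoE)
     (auto simp: hdomino_eq_squares vdomino_eq_squares center_in_square)

lemma square_subset_diamond_iff:
  "lattice_square a b \<subseteq> {(x, y). \<bar>x\<bar> + \<bar>y\<bar> \<le> real n + 1} \<longleftrightarrow> in_aztec n a b"
proof
  assume sub: "lattice_square a b \<subseteq> {(x, y). \<bar>x\<bar> + \<bar>y\<bar> \<le> real n + 1}"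
  have corner: "\<bar>c\<bar> + \<bar>d\<bar> \<le> int n + 1" if "c \<in> {a, a + 1}" "d \<in> {b, b + 1}" for c d
  proof -
    have "(real_of_int c, real_of_int d) \<in> lattice_square a b"
      using that by (auto simp: lattice_square_def)
    then have "\<bar>real_of_int c\<bar> + \<bar>real_of_int d\<bar> \<le> real n + 1" using sub by auto
    then show ?thesis by linarith
  qed
  show "in_aztec n a b"
  proof -
    have "\<bar>a\<bar> + \<bar>b\<bar> \<le> int n + 1" "\<bar>a + 1\<bar> + \<bar>b\<bar> \<le> int n + 1"
      "\<bar>a\<bar> + \<bar>b + 1\<bar> \<le> int n + 1" "\<bar>a + 1\<bar> + \<bar>b + 1\<bar> \<le> int n + 1"
      by (rule corner; simp)+
    then show ?thesis unfolding in_aztec_def by linarith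
  qed
next
  assume "in_aztec n a b"
  then have *: "\<bar>real_of_int a + real_of_int b + 1\<bar> \<le> real n" "\<bar>real_of_int a - real_of_int b\<bar> \<le> real n"
    unfolding in_aztec_def by linarith+
  show "lattice_square a b \<subseteq> {(x, y). \<bar>x\<bar> + \<bar>y\<bar> \<le> real n + 1}"
  proof
    fix p assume "p \<in> lattice_square a b"
    then obtain x y where p: "p = (x, y)" "real_of_int a \<le> x" "x \<le> real_of_int a + 1"
      "real_of_int b \<le> y" "y \<le> real_of_int b + 1" by (auto simp: lattice_square_def)
    then have "\<bar>x + y\<bar> \<le> real n + 1" "\<bar>x - y\<bar> \<le> real n + 1" using * by linarith+
    then have "\<bar>x\<bar> + \<bar>y\<bar> \<le> real n + 1" by linarith
    then show "p \<in> {(x, y). \<bar>x\<bar> + \<bar>y\<bar> \<le> real n + 1}" using p(1) by simp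
  qed
qed

lemma aztec_diamond_eq: "aztec_diamond n = (\<Union>(a, b)\<in>{(a, b). in_aztec n a b}. lattice_square a b)"
  unfolding aztec_diamond_def square_subset_diamond_iff by auto

lemma center_in_aztec_diamond: "cell_center a b \<in> aztec_diamond n \<longleftrightarrow> in_aztec n a b"
  by (auto simp: aztec_diamond_eq center_in_square)

definition coverage :: "region set \<Rightarrow> int \<Rightarrow> int \<Rightarrow> int" where
  "coverage T a b = of_bool (hdomino a b \<in> T) + of_bool (hdomino (a - 1) b \<in> T) +
     of_bool (vdomino a b \<in> T) + of_bool (vdomino a (b - 1) \<in> T)"

text \<open>A domino contains the centre of a square only if it is one of the four that cover this square.\<close>

lemma coverage_eq_card:
  assumes "\<And>D. D \<in> T \<Longrightarrow> domino D"
  shows "coverage T a b = int (card {D \<in> T. cell_center a b \<in> D})"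
    and "finite {D \<in> T. cell_center a b \<in> D}"
proof -
  let ?S = "{hdomino a b, hdomino (a - 1) b, vdomino a b, vdomino a (b - 1)}"
  have *: "{D \<in> T. cell_center a b \<in> D} = {D \<in> ?S. D \<in> T}"
  proof (intro set_eqI iffI)
    fix D assume D: "D \<in> {D \<in> T. cell_center a b \<in> D}"
    then have "domino D" using assms by auto
    then show "D \<in> {D \<in> ?S. D \<in> T}"
      using D by (cases rule: dominoE) (auto simp: center_in_hdomino center_in_vdomino)
  qed (auto simp: center_in_hdomino center_in_vdomino)
  then show "finite {D \<in> T. cell_center a b \<in> D}" by simp
  have "int (card {D \<in> ?S. D \<in> T}) = (\<Sum>D\<in>?S. of_bool (D \<in> T))"
    by (simp add: sum.If_cases of_bool_def Int_def)
  also have "\<dots> = coverage T a b" by (simp add: coverage_def)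
  finally show "coverage T a b = int (card {D \<in> T. cell_center a b \<in> D})" by (simp add: *)
qed

text \<open>Two dominoes have overlapping interiors iff they share a square, and hence the centre of that square, which
  lies in the interior of each. So a tiling is a set of dominoes that covers each square of the diamond exactly
  once, and no other square.\<close>

lemma domino_tiling_iff:
  "domino_tiling (aztec_diamond n) T \<longleftrightarrow>
     (\<forall>D\<in>T. domino D) \<and> (\<forall>a b. coverage T a b = of_bool (in_aztec n a b))"
proof (cases "\<forall>D\<in>T. domino D")
  case dom: True
  then have dom': "\<And>D. D \<in> T \<Longrightarrow> domino D" by blast
  have cov: "coverage T a b = int (card {D \<in> T. cell_center a b \<in> D})"
    "finite {D \<in> T. cell_center a b \<in> D}" for a b
    by (rule coverage_eq_card; rule dom'; assumption)+
  show ?thesis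
  proof
    assume T: "domino_tiling (aztec_diamond n) T"
    have "coverage T a b = of_bool (in_aztec n a b)" for a b
    proof (cases "in_aztec n a b")
      case True
      then obtain D where D: "D \<in> T" "cell_center a b \<in> D"
        using T center_in_aztec_diamond[of a b n] by (auto simp: domino_tiling_def)
      have "E = D" if "E \<in> T" "cell_center a b \<in> E" for E
      proof (rule ccontr)
        assume "E \<noteq> D"
        then have "interior E \<inter> interior D = {}"
          using T that D by (auto simp: domino_tiling_def pairwise_def)
        then show False using center_in_interior dom' D that by blast
      qed
      with D have "{D \<in> T. cell_center a b \<in> D} = {D}" by blast
      then show ?thesis using True by (simp add: cov(1))
    next
      case False
      then have "{D \<in> T. cell_center a b \<in> D} = {}"
        using T center_in_aztec_diamond[of a b n] by (auto simp: domino_tiling_def)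
      then show ?thesis using False by (simp add: cov(1) del: Collect_empty_eq)
    qed
    then show "(\<forall>D\<in>T. domino D) \<and> (\<forall>a b. coverage T a b = of_bool (in_aztec n a b))"
      using dom by blast
  next
    assume "(\<forall>D\<in>T. domino D) \<and> (\<forall>a b. coverage T a b = of_bool (in_aztec n a b))"
    then have c: "coverage T a b = of_bool (in_aztec n a b)" for a b by blast
    have "pairwise (\<lambda>D E. interior D \<inter> interior E = {}) T"
    proof (rule pairwiseI)
      fix D E assume DE: "D \<in> T" "E \<in> T" "D \<noteq> E"
      show "interior D \<inter> interior E = {}"
      proof (rule ccontr)
        assume "interior D \<inter> interior E \<noteq> {}"
        then obtain x y where "(x, y) \<in> interior D" "(x, y) \<in> interior E" by auto
        then have "{D, E} \<subseteq> {D \<in> T. cell_center \<lfloor>x\<rfloor> \<lfloor>y\<rfloor> \<in> D}"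
          using DE dom' center_of_interior_point by blast
        then have "card {D, E} \<le> card {D \<in> T. cell_center \<lfloor>x\<rfloor> \<lfloor>y\<rfloor> \<in> D}"
          using cov(2) by (rule card_mono[rotated])
        then have "2 \<le> coverage T \<lfloor>x\<rfloor> \<lfloor>y\<rfloor>" using DE by (simp add: cov(1))
        then show False unfolding c by (simp add: of_bool_def split: if_splits)
      qed
    qed
    moreover have "\<Union> T = aztec_diamond n"
    proof
      show "\<Union> T \<subseteq> aztec_diamond n"
      proof
        fix p assume "p \<in> \<Union> T"
        then obtain D where D: "D \<in> T" "p \<in> D" by blast
        then obtain a b where ab: "p \<in> lattice_square a b" "cell_center a b \<in> D"
          using domino_point_square dom' by metis
        then have "card {D \<in> T. cell_center a b \<in> D} \<noteq> 0" using cov(2) D by auto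
        then have "in_aztec n a b" using c[of a b] cov(1)[of a b] by (cases "in_aztec n a b") auto
        then show "p \<in> aztec_diamond n" using ab by (auto simp: aztec_diamond_eq)
      qed
      show "aztec_diamond n \<subseteq> \<Union> T"
      proof
        fix p assume "p \<in> aztec_diamond n"
        then obtain a b where ab: "p \<in> lattice_square a b" "in_aztec n a b"
          by (auto simp: aztec_diamond_eq)
        then have "card {D \<in> T. cell_center a b \<in> D} \<noteq> 0" using c[of a b] cov(1)[of a b] by simp
        then have "{D \<in> T. cell_center a b \<in> D} \<noteq> {}" by (metis card.empty)
        then obtain D where "D \<in> T" "cell_center a b \<in> D" by blast
        then show "p \<in> \<Union> T" using square_subset_domino dom' ab by blast
      qed
    qed
    ultimately show "domino_tiling (aztec_diamond n) T" using dom by (simp add: domino_tiling_def)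
  qed
next
  case False
  then show ?thesis by (auto simp: domino_tiling_def)
qed

lemma tiling_cover:
  assumes T: "domino_tiling (aztec_diamond n) T"
  shows "coverage T a b = of_bool (in_aztec n a b)"
    and "D \<in> T \<Longrightarrow> domino D"
    and "vdomino a b \<in> T \<Longrightarrow> in_aztec n a b \<and> in_aztec n a (b + 1)"
    and "hdomino a b \<in> T \<Longrightarrow> in_aztec n a b \<and> in_aztec n (a + 1) b"
proof -
  have c: "coverage T a b = of_bool (in_aztec n a b)" for a b
    using T by (simp add: domino_tiling_iff)
  show "coverage T a b = of_bool (in_aztec n a b)" by (rule c)
  show "D \<in> T \<Longrightarrow> domino D" using T by (simp add: domino_tiling_iff)
  show "vdomino a b \<in> T \<Longrightarrow> in_aztec n a b \<and> in_aztec n a (b + 1)"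
    using c[of a b] c[of a "b + 1"] by (auto simp: coverage_def of_bool_def split: if_splits)
  show "hdomino a b \<in> T \<Longrightarrow> in_aztec n a b \<and> in_aztec n (a + 1) b"
    using c[of a b] c[of "a + 1" b] by (auto simp: coverage_def of_bool_def split: if_splits)
qed

text \<open>Whether a domino lies across the edge from \<open>(x, y)\<close> to \<open>(x, y + 1)\<close>. The dependence on parity makes
  the four edges of every square carry exactly one crossing.\<close>

definition crossed :: "nat \<Rightarrow> (int \<Rightarrow> int \<Rightarrow> int) \<Rightarrow> int \<Rightarrow> int \<Rightarrow> bool" where
  "crossed n h x y \<longleftrightarrow> h x (y + 1) - h x y = of_bool (odd (x + y + int n))"

definition tiling_of :: "nat \<Rightarrow> (int \<Rightarrow> int \<Rightarrow> int) \<Rightarrow> region set" where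
  "tiling_of n h =
     {hdomino a b | a b. in_aztec n a b \<and> in_aztec n (a + 1) b \<and> crossed n h (a + 1) b} \<union>
     {vdomino a b | a b. h a (b + 1) \<noteq> h (a + 1) (b + 1)}"

lemma hdomino_in_tiling_of:
  "hdomino a b \<in> tiling_of n h \<longleftrightarrow> in_aztec n a b \<and> in_aztec n (a + 1) b \<and> crossed n h (a + 1) b"
  by (auto simp: tiling_of_def)

lemma vdomino_in_tiling_of: "vdomino a b \<in> tiling_of n h \<longleftrightarrow> h a (b + 1) \<noteq> h (a + 1) (b + 1)"
  by (auto simp: tiling_of_def)

text \<open>On the boundary of the diamond the height is \<open>vac\<close>, and the parity is such that no domino sticks
  out.\<close>

lemma not_crossed_right_boundary:
  assumes h: "h \<in> heights n" and "in_aztec n a b" "\<not> in_aztec n (a + 1) b"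
  shows "\<not> crossed n h (a + 1) b"
proof -
  have "h (a + 1) b = vac b" "h (a + 1) (b + 1) = vac (b + 1)"
    using assms(2,3) by (intro heightsD(7)[OF h]; simp add: in_aztec_def; linarith)+
  moreover have "(b \<ge> 0 \<and> even (a + 1 + b + int n)) \<or> (b < 0 \<and> odd (a + 1 + b + int n))"
  proof (cases "b \<ge> 0")
    case True
    then have "int n = a + 1 + b" using assms(2,3) unfolding in_aztec_def by linarith
    then show ?thesis using True by simp
  next
    case False
    then have "int n = a - b" using assms(2,3) unfolding in_aztec_def by linarith
    then show ?thesis using False by simp
  qed
  ultimately show ?thesis by (auto simp: crossed_def vac_def)
qed

lemma not_crossed_left_boundary:
  assumes h: "h \<in> heights n" and "in_aztec n a b" "\<not> in_aztec n (a - 1) b"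
  shows "\<not> crossed n h a b"
proof -
  have "h a b = vac b" "h a (b + 1) = vac (b + 1)"
    using assms(2,3) by (intro heightsD(7)[OF h]; simp add: in_aztec_def; linarith)+
  moreover have "(b \<ge> 0 \<and> even (a + b + int n)) \<or> (b < 0 \<and> odd (a + b + int n))"
  proof (cases "b \<ge> 0")
    case True
    then have "int n = b - a" using assms(2,3) unfolding in_aztec_def by linarith
    then show ?thesis using True by simp
  next
    case False
    then have "int n = - a - b - 1" using assms(2,3) unfolding in_aztec_def by linarith
    then show ?thesis using False by simp
  qed
  ultimately show ?thesis by (auto simp: crossed_def vac_def)
qed

text \<open>Going around a square the height differences add up to \<open>0\<close>, which says that exactly one of its
  four edges is crossed.\<close>

lemma tiling_of_is_tiling:
  assumes h: "h \<in> heights n"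
  shows "domino_tiling (aztec_diamond n) (tiling_of n h)"
  unfolding domino_tiling_iff
proof (intro conjI allI)
  show "\<forall>D\<in>tiling_of n h. domino D" by (auto simp: tiling_of_def)
  fix a b
  note D = heightsD[OF h]
  show "coverage (tiling_of n h) a b = of_bool (in_aztec n a b)"
  proof (cases "in_aztec n a b")
    case True
    have "coverage (tiling_of n h) a b = of_bool (crossed n h (a + 1) b) + of_bool (crossed n h a b) +
      of_bool (h a (b + 1) \<noteq> h (a + 1) (b + 1)) + of_bool (h a b \<noteq> h (a + 1) b)"
      using not_crossed_left_boundary[OF h True] not_crossed_right_boundary[OF h True] True
      by (auto simp: coverage_def hdomino_in_tiling_of vdomino_in_tiling_of)
    also have "\<dots> = 1"
    proof (cases "even (a + b + int n)")
      case True
      then have p: "odd (a + 1 + b + int n)" "odd (a + (b + 1) + int n)" by presburger+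
      show ?thesis
        using D(1,2)[of a b] D(1,2)[of "a + 1" b] D(3,4)[OF True] D(5,6)[OF p(2)] True p(1)
        unfolding crossed_def of_bool_def by (simp split: if_split)
    next
      case False
      then have p: "even (a + 1 + b + int n)" "even (a + (b + 1) + int n)" by presburger+
      show ?thesis
        using D(1,2)[of a b] D(1,2)[of "a + 1" b] D(5,6)[OF False] D(3,4)[OF p(2)] False p(1)
        unfolding crossed_def of_bool_def by (simp split: if_split)
    qed
    finally show ?thesis using True by simp
  next
    case False
    then have "h a b = vac b" "h (a + 1) b = vac b" "h a (b + 1) = vac (b + 1)"
      "h (a + 1) (b + 1) = vac (b + 1)"
      by (intro D(7); simp add: in_aztec_def; linarith)+
    then show ?thesis using False
      by (auto simp: coverage_def hdomino_in_tiling_of vdomino_in_tiling_of)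
  qed
qed

text \<open>Integrate along a row, starting from the boundary: passing a vertical domino changes the height by
  \<open>1\<close> or \<open>- 1\<close>, according to parity.\<close>

definition height_of :: "nat \<Rightarrow> region set \<Rightarrow> int \<Rightarrow> int \<Rightarrow> int" where
  "height_of n T x y = vac y + (\<Sum>x'\<in>{-int n..<x}.
     (if even (x' + y + int n) then 1 else -1) * of_bool (vdomino x' (y - 1) \<in> T))"

lemma atLeastLessThan_succ_int: "m \<le> x \<Longrightarrow> {m..<x + 1} = insert x {m..<x :: int}"
  by auto

lemma height_of_tiling_of:
  assumes h: "h \<in> heights n"
  shows "height_of n (tiling_of n h) = h"
proof (intro ext)
  fix x y
  note D = heightsD[OF h]
  have step: "(if even (x' + y + int n) then 1 else -1) * of_bool (vdomino x' (y - 1) \<in> tiling_of n h) =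
      h (x' + 1) y - h x' y" for x'
    using D(3-6)[of x' y] by (cases "even (x' + y + int n)") (auto simp: vdomino_in_tiling_of)
  show "height_of n (tiling_of n h) x y = h x y"
  proof (cases "x \<ge> - int n")
    case True
    then have "(\<Sum>x'\<in>{-int n..<x}. h (x' + 1) y - h x' y) = h x y - h (- int n) y"
      by (induction x rule: int_ge_induct) (auto simp: atLeastLessThan_succ_int)
    then show ?thesis unfolding height_of_def step using D(7)[of "- int n" y] by simp
  next
    case False
    then show ?thesis using D(7)[of x y] by (simp add: height_of_def)
  qed
qed

lemma height_of_step:
  assumes T: "domino_tiling (aztec_diamond n) T"
  shows "height_of n T (x + 1) y = height_of n T x y +
     (if even (x + y + int n) then 1 else -1) * of_bool (vdomino x (y - 1) \<in> T)"
proof (cases "x \<ge> - int n")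
  case True
  then show ?thesis by (simp add: height_of_def atLeastLessThan_succ_int)
next
  case False
  then have "\<not> in_aztec n x (y - 1)" unfolding in_aztec_def by linarith
  then have "vdomino x (y - 1) \<notin> T" using tiling_cover(3)[OF T] by blast
  then show ?thesis using False by (simp add: height_of_def)
qed

text \<open>The horizontal dominoes that continue the all-horizontals tiling outside the diamond. With them every tiling
  of the diamond extends to a tiling of the plane (\<open>plane_cover\<close>), so that vertical differences of the height can
  be computed by induction along a row that starts outside the diamond.\<close>

definition bricks :: "nat \<Rightarrow> int \<Rightarrow> int \<Rightarrow> bool" where
  "bricks n a b \<longleftrightarrow> \<not> in_aztec n a b \<and> \<not> in_aztec n (a + 1) b \<and> (even (a + b + int n) \<longleftrightarrow> b \<ge> 0)"

lemma plane_cover: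
  assumes T: "domino_tiling (aztec_diamond n) T"
  shows "of_bool (hdomino a b \<in> T \<or> bricks n a b) + of_bool (hdomino (a - 1) b \<in> T \<or> bricks n (a - 1) b) +
     of_bool (vdomino a b \<in> T) + of_bool (vdomino a (b - 1) \<in> T) = (1 :: int)"
proof (cases "in_aztec n a b")
  case True
  then have "\<not> bricks n a b" "\<not> bricks n (a - 1) b" by (simp_all add: bricks_def)
  then show ?thesis using tiling_cover(1)[OF T, of a b] True by (simp add: coverage_def)
next
  case False
  then have "hdomino a b \<notin> T" "hdomino (a - 1) b \<notin> T" "vdomino a b \<notin> T" "vdomino a (b - 1) \<notin> T"
    using tiling_cover(3)[OF T, of a b] tiling_cover(3)[OF T, of a "b - 1"]
      tiling_cover(4)[OF T, of a b] tiling_cover(4)[OF T, of "a - 1" b] by auto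
  moreover have "bricks n a b \<longleftrightarrow> \<not> bricks n (a - 1) b"
  proof -
    have par: "even (a - 1 + b + int n) \<longleftrightarrow> odd (a + b + int n)" by presburger
    consider "in_aztec n (a + 1) b" | "in_aztec n (a - 1) b"
      | "\<not> in_aztec n (a + 1) b" "\<not> in_aztec n (a - 1) b" by blast
    then show ?thesis
    proof cases
      case 1
      then have "\<not> in_aztec n (a - 1) b" using False unfolding in_aztec_def by linarith
      moreover have "odd (a + b + int n) \<longleftrightarrow> b \<ge> 0"
      proof (cases "b \<ge> 0")
        case True
        then have "int n = b - a - 1" using 1 False unfolding in_aztec_def by linarith
        then show ?thesis using True by simp
      next
        case False
        then have "int n = - a - b - 2" using 1 \<open>\<not> in_aztec n a b\<close> unfolding in_aztec_def by linarith
        then show ?thesis using False by simp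
      qed
      ultimately show ?thesis unfolding bricks_def par using 1 False by simp
    next
      case 2
      then have "\<not> in_aztec n (a + 1) b" using False unfolding in_aztec_def by linarith
      moreover have "even (a + b + int n) \<longleftrightarrow> b \<ge> 0"
      proof (cases "b \<ge> 0")
        case True
        then have "int n = a + b" using 2 False unfolding in_aztec_def by linarith
        then show ?thesis using True by simp
      next
        case False
        then have "int n = a - b - 1" using 2 \<open>\<not> in_aztec n a b\<close> unfolding in_aztec_def by linarith
        then show ?thesis using False by simp
      qed
      ultimately show ?thesis unfolding bricks_def par using 2 False by simp
    next
      case 3
      then show ?thesis using False par by (auto simp: bricks_def)
    qed
  qed
  ultimately show ?thesis by simp
qed

text \<open>By induction on \<open>x\<close>: passing the square with lower left corner \<open>(x, y)\<close>, the change of the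
  difference is determined by the vertical dominoes covering this square, and exactly one domino covers it.\<close>

lemma height_of_vertical:
  assumes T: "domino_tiling (aztec_diamond n) T"
  shows "x \<ge> - int n - 1 \<Longrightarrow> height_of n T x (y + 1) - height_of n T x y =
    (if odd (x + y + int n) then of_bool (hdomino (x - 1) y \<in> T \<or> bricks n (x - 1) y)
     else 1 - of_bool (hdomino (x - 1) y \<in> T \<or> bricks n (x - 1) y))"
proof (induction x rule: int_ge_induct)
  case base
  have out: "\<not> in_aztec n (- int n - 1 - 1) y" "\<not> in_aztec n (- int n - 1 - 1 + 1) y"
    unfolding in_aztec_def by linarith+
  then have "hdomino (- int n - 1 - 1) y \<notin> T" using tiling_cover(4)[OF T] by blast
  moreover have "bricks n (- int n - 1 - 1) y \<longleftrightarrow> (even y \<longleftrightarrow> y \<ge> 0)"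
    unfolding bricks_def using out by simp
  moreover have "height_of n T (- int n - 1) y = vac y" for y by (simp add: height_of_def)
  moreover have "odd (- int n - 1 + y + int n) \<longleftrightarrow> even y" by simp
  ultimately show ?case by (auto simp: vac_def)
next
  case (step x)
  have c: "of_bool (hdomino x y \<in> T \<or> bricks n x y) =
      1 - of_bool (hdomino (x - 1) y \<in> T \<or> bricks n (x - 1) y) -
      of_bool (vdomino x y \<in> T) - (of_bool (vdomino x (y - 1) \<in> T) :: int)"
    using plane_cover[OF T, of x y] by linarith
  have h: "height_of n T (x + 1) (y + 1) - height_of n T (x + 1) y =
      height_of n T x (y + 1) - height_of n T x y -
      (if even (x + y + int n) then 1 else -1) * (of_bool (vdomino x y \<in> T) + of_bool (vdomino x (y - 1) \<in> T))"
  proof -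
    have "even (x + (y + 1) + int n) \<longleftrightarrow> odd (x + y + int n)" by presburger
    then show ?thesis using height_of_step[OF T, of x y] height_of_step[OF T, of x "y + 1"] by simp
  qed
  have par: "odd (x + 1 + y + int n) \<longleftrightarrow> even (x + y + int n)" by presburger
  show ?case
    unfolding h step.IH par using c by (cases "even (x + y + int n)") simp_all
qed

text \<open>The formula for the height starts at the left boundary, so the boundary values on the right need an argument:
  to the right of the diamond the vertical differences are those of \<open>vac\<close>, and rows that do not meet the
  diamond have no vertical dominoes.\<close>

lemma height_of_heights:
  assumes T: "domino_tiling (aztec_diamond n) T"
  shows "height_of n T \<in> heights n"
proof -
  let ?h = "height_of n T"
  have left: "?h x y = vac y" if "x \<le> - (int n - \<bar>y\<bar>) \<or> x \<le> - int n" for x y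
  proof -
    have "vdomino x' (y - 1) \<notin> T" if "x' < x" for x'
    proof
      assume "vdomino x' (y - 1) \<in> T"
      then have "in_aztec n x' (y - 1)" "in_aztec n x' y" using tiling_cover(3)[OF T, of x' "y - 1"] by auto
      then show False using that \<open>_ \<or> _\<close> unfolding in_aztec_def by linarith
    qed
    then show ?thesis by (simp add: height_of_def)
  qed
  have vert: "?h x y \<le> ?h x (y + 1) \<and> ?h x (y + 1) \<le> ?h x y + 1" for x y
  proof (cases "x \<ge> - int n - 1")
    case True
    show ?thesis using height_of_vertical[OF T True, of y] by (auto split: if_splits simp: of_bool_def)
  next
    case False
    then show ?thesis using left[of x y] left[of x "y + 1"] by (auto simp: vac_def)
  qed
  have const: "?h x' y = ?h x y" if "x \<ge> int n - \<bar>y\<bar>" "x \<le> x'" for x x' y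
    using that(2)
  proof (induction x' rule: int_ge_induct)
    case (step x')
    have "vdomino x' (y - 1) \<notin> T"
    proof
      assume "vdomino x' (y - 1) \<in> T"
      then have "in_aztec n x' (y - 1)" "in_aztec n x' y" using tiling_cover(3)[OF T, of x' "y - 1"] by auto
      then show False using that(1) step.hyps unfolding in_aztec_def by linarith
    qed
    then show ?case using height_of_step[OF T, of x' y] step.IH by simp
  qed simp
  have far: "?h (int n + 1) y = vac y" for y
  proof -
    have st: "?h (int n + 1) (y + 1) - ?h (int n + 1) y = of_bool (y \<ge> 0)" for y
    proof -
      have out: "\<not> in_aztec n (int n + 1 - 1) y" "\<not> in_aztec n (int n + 1) y"
        unfolding in_aztec_def by linarith+
      then have "hdomino (int n + 1 - 1) y \<notin> T" using tiling_cover(4)[OF T] by blast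
      moreover have "bricks n (int n + 1 - 1) y \<longleftrightarrow> (even y \<longleftrightarrow> y \<ge> 0)"
        using out by (simp add: bricks_def)
      moreover have "odd (int n + 1 + y + int n) \<longleftrightarrow> even y" by simp
      ultimately show ?thesis using height_of_vertical[OF T, of "int n + 1" y] by simp
    qed
    have base: "?h (int n + 1) y = vac y" if "\<bar>y\<bar> \<ge> int n" for y
      using const[where x = "int n - \<bar>y\<bar>" and x' = "int n + 1" and y = y]
        left[where x = "int n - \<bar>y\<bar>" and y = y] that by simp
    show ?thesis
    proof (cases "y \<ge> - int n")
      case True
      then show ?thesis
      proof (induction y rule: int_ge_induct)
        case base
        show ?case by (rule \<open>\<And>y. \<bar>y\<bar> \<ge> int n \<Longrightarrow> ?h (int n + 1) y = vac y\<close>) simp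
      next
        case (step y)
        then show ?case using st[of y] by (cases "y \<ge> 0") (simp_all add: vac_def)
      qed
    qed (auto intro: base)
  qed
  have "?h x y = vac y" if "\<bar>x\<bar> + \<bar>y\<bar> \<ge> int n" for x y
  proof (cases "x \<ge> int n - \<bar>y\<bar>")
    case True
    have "?h (max x (int n + 1)) y = ?h x y" by (rule const[OF True]) simp
    moreover have "?h (max x (int n + 1)) y = ?h (int n + 1) y" by (rule const) auto
    ultimately show ?thesis using far[of y] by simp
  next
    case False
    then show ?thesis using that by (intro left) linarith
  qed
  moreover have "even (x + y + int n) \<Longrightarrow> ?h x y \<le> ?h (x + 1) y \<and> ?h (x + 1) y \<le> ?h x y + 1"
    "odd (x + y + int n) \<Longrightarrow> ?h (x + 1) y \<le> ?h x y \<and> ?h x y \<le> ?h (x + 1) y + 1" for x y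
    using height_of_step[OF T, of x y] by (simp_all add: of_bool_def)
  ultimately show ?thesis using vert unfolding heights_def by blast
qed

lemma tiling_of_height_of:
  assumes T: "domino_tiling (aztec_diamond n) T"
  shows "tiling_of n (height_of n T) = T"
proof -
  have v: "vdomino a b \<in> tiling_of n (height_of n T) \<longleftrightarrow> vdomino a b \<in> T" for a b
    using height_of_step[OF T, of a "b + 1"] by (auto simp: vdomino_in_tiling_of split: if_splits)
  have h: "hdomino a b \<in> tiling_of n (height_of n T) \<longleftrightarrow> hdomino a b \<in> T" for a b
  proof (cases "in_aztec n a b \<and> in_aztec n (a + 1) b")
    case True
    then have "a + 1 \<ge> - int n - 1" "\<not> bricks n a b" by (auto simp: in_aztec_def bricks_def)
    then show ?thesis using True height_of_vertical[OF T, of "a + 1" b]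
      by (auto simp: hdomino_in_tiling_of crossed_def split: if_splits)
  next
    case False
    then show ?thesis using tiling_cover(4)[OF T, of a b] by (auto simp: hdomino_in_tiling_of)
  qed
  show ?thesis
  proof (rule set_eqI)
    fix D
    show "D \<in> tiling_of n (height_of n T) \<longleftrightarrow> D \<in> T"
    proof (cases "domino D")
      case True
      then show ?thesis by (cases rule: dominoE) (simp_all add: v h)
    next
      case False
      then show ?thesis using tiling_cover(2)[OF T] by (auto simp: tiling_of_def)
    qed
  qed
qed

lemma bij_betw_tiling_of:
  "bij_betw (tiling_of n) (heights n) {T. domino_tiling (aztec_diamond n) T}"
  by (rule bij_betwI[where g = "height_of n"])
     (auto simp: tiling_of_is_tiling height_of_heights height_of_tiling_of tiling_of_height_of)

section \<open>Rank, vertical dominoes and the generating function\<close>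

lemma vac_heights: "(\<lambda>x. vac) \<in> heights n"
  by (auto simp: heights_def vac_def)

lemma all_horizontals_eq: "all_horizontals n = tiling_of n (\<lambda>x. vac)"
  unfolding all_horizontals_def
proof (rule the_equality)
  show "domino_tiling (aztec_diamond n) (tiling_of n (\<lambda>x. vac)) \<and>
      (\<forall>D\<in>tiling_of n (\<lambda>x. vac). horizontal_domino D)"
    using tiling_of_is_tiling[OF vac_heights] by (auto simp: tiling_of_def)
  fix T assume T: "domino_tiling (aztec_diamond n) T \<and> (\<forall>D\<in>T. horizontal_domino D)"
  then have "vdomino a b \<notin> T" for a b by (metis domino_simps(4))
  then have "height_of n T = (\<lambda>x. vac)" by (intro ext) (simp add: height_of_def)
  then show "T = tiling_of n (\<lambda>x. vac)" using tiling_of_height_of[of n T] T by simp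
qed

lemma excess_vac [simp]: "excess n (\<lambda>x. vac) = 0"
  by (simp add: excess_def)

lemma finite_support:
  assumes "h \<in> heights n"
  shows "{(x, y). h x y \<noteq> vac y} \<subseteq> {-int n..int n} \<times> {-int n..int n}"
    and "finite {(x, y). h x y \<noteq> vac y}"
proof -
  have "\<bar>x\<bar> + \<bar>y\<bar> < int n" if "h x y \<noteq> vac y" for x y
    using heightsD(7)[OF assms, of x y] that by linarith
  then show *: "{(x, y). h x y \<noteq> vac y} \<subseteq> {-int n..int n} \<times> {-int n..int n}"
    by fastforce
  show "finite {(x, y). h x y \<noteq> vac y}" by (rule finite_subset[OF *]) simp
qed

text \<open>Among the points with positive excess choose one at which Thurston's height function is largest. If the height could not be lowered there without violating the condition on some edge, then the other
  end of that edge would have positive excess too and a larger value of that function.\<close>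

lemma lowerable_vertex:
  assumes h: "h \<in> heights n" and ne: "h \<noteq> (\<lambda>x. vac)"
  obtains u v where "vac v < h u v" "h u (v + 1) = h u v" "h u (v - 1) = h u v - 1"
    "h (u - 1) v = h u v - of_bool (odd (u + v + int n))"
    "h (u + 1) v = h u v - of_bool (odd (u + v + int n))"
proof -
  note D = heightsD[OF h]
  define S where "S = {(x, y). h x y \<noteq> vac y}"
  define \<phi> where "\<phi> = (\<lambda>(x, y). 4 * h x y - 2 * y + of_bool (even (x + y + int n)))"
  have fin: "finite S" unfolding S_def by (rule finite_support[OF h])
  have "S \<noteq> {}" using ne by (auto simp: S_def fun_eq_iff)
  then have "Max (\<phi> ` S) \<in> \<phi> ` S" using fin by (intro Max_in) auto
  then obtain u v where uv: "(u, v) \<in> S" "\<phi> (u, v) = Max (\<phi> ` S)" by force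
  have max: "\<phi> (x, y) \<le> \<phi> (u, v)" if "vac y < h x y" for x y
    unfolding uv(2) using fin that by (intro Max_ge) (auto simp: S_def)
  have pos: "vac v < h u v" using uv(1) heights_ge_vac[OF h, of v u] by (auto simp: S_def)
  have up: "h u (v + 1) = h u v"
  proof (rule ccontr)
    assume "h u (v + 1) \<noteq> h u v"
    then have e: "h u (v + 1) = h u v + 1" using D(1,2)[of u v] by linarith
    then have "vac (v + 1) < h u (v + 1)" using pos by (auto simp: vac_def)
    from max[OF this] show False by (auto simp: \<phi>_def e of_bool_def split: if_splits)
  qed
  have down: "h u (v - 1) = h u v - 1"
  proof (rule ccontr)
    assume "h u (v - 1) \<noteq> h u v - 1"
    then have e: "h u (v - 1) = h u v" using D(1,2)[of u "v - 1"] by simp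
    then have "vac (v - 1) < h u (v - 1)" using pos by (auto simp: vac_def)
    from max[OF this] show False by (auto simp: \<phi>_def e of_bool_def split: if_splits)
  qed
  have side: "h x v = h u v - of_bool (odd (u + v + int n))" if x: "x = u - 1 \<or> x = u + 1" for x
  proof (rule ccontr)
    assume neq: "h x v \<noteq> h u v - of_bool (odd (u + v + int n))"
    have par: "even (x + v + int n) \<longleftrightarrow> odd (u + v + int n)" using x by auto
    have "h x v = h u v + of_bool (even (u + v + int n))"
    proof (cases "even (u + v + int n)")
      case True
      then have "odd (u - 1 + v + int n)" by presburger
      then show ?thesis using D(3,4)[OF True] D(5,6)[of "u - 1" v] neq x True by auto
    next
      case False
      then have "even (u - 1 + v + int n)" by presburger
      then show ?thesis using D(5,6)[OF False] D(3,4)[of "u - 1" v] neq x False by auto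
    qed
    moreover from this have "vac v < h x v" using pos by simp
    from max[OF this] have "4 * h x v + of_bool (even (x + v + int n)) \<le>
        4 * h u v + of_bool (even (u + v + int n))" by (simp add: \<phi>_def)
    ultimately show False using par by (cases "even (u + v + int n)") auto
  qed
  show ?thesis using that[OF pos up down] side by blast
qed

lemma height_lower_step:
  assumes h: "h \<in> heights n" and ne: "h \<noteq> (\<lambda>x. vac)"
  obtains h' where "h' \<in> heights n" "excess n h = Suc (excess n h')"
    "(tiling_of n h', tiling_of n h) \<in> elementary_moves (aztec_diamond n)"
proof -
  note D = heightsD[OF h]
  obtain u v where uv: "vac v < h u v" "h u (v + 1) = h u v" "h u (v - 1) = h u v - 1"
    "h (u - 1) v = h u v - of_bool (odd (u + v + int n))"
    "h (u + 1) v = h u v - of_bool (odd (u + v + int n))"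
    using lowerable_vertex[OF h ne] by blast
  define h' where "h' x y = h x y - of_bool (x = u \<and> y = v)" for x y
  have inside: "\<bar>u\<bar> + \<bar>v\<bar> < int n" using D(7)[of u v] uv(1) by linarith
  have h': "h' \<in> heights n"
    unfolding heights_def mem_Collect_eq
  proof (intro conjI allI impI)
    fix x y
    show "h' x y \<le> h' x (y + 1)" "h' x (y + 1) \<le> h' x y + 1"
      using D(1,2)[of x y] uv(2,3) by (auto simp: h'_def of_bool_def split: if_splits)
    show "h' x y \<le> h' (x + 1) y" "h' (x + 1) y \<le> h' x y + 1" if "even (x + y + int n)"
      using D(3,4)[OF that] uv(4,5) that by (auto simp: h'_def of_bool_def split: if_splits)
    show "h' (x + 1) y \<le> h' x y" "h' x y \<le> h' (x + 1) y + 1" if "odd (x + y + int n)"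
      using D(5,6)[OF that] uv(4,5) that by (auto simp: h'_def of_bool_def split: if_splits)
    show "h' x y = vac y" if "int n \<le> \<bar>x\<bar> + \<bar>y\<bar>"
      using D(7)[OF that] inside that by (auto simp: h'_def)
  qed
  have "int (excess n h) = int (Suc (excess n h'))"
  proof -
    have e: "int (excess n g) = (\<Sum>y\<in>{-int n..int n}. \<Sum>x\<in>{-int n..int n}. g x y - vac y)"
      if "g \<in> heights n" for g
      using heights_ge_vac[OF that] by (simp add: excess_def)
    have "(\<Sum>y\<in>{-int n..int n}. \<Sum>x\<in>{-int n..int n}. of_bool (x = u \<and> y = v)) = (1 :: int)"
    proof -
      have "(\<Sum>x\<in>{-int n..int n}. of_bool (x = u \<and> y = v)) = (if y = v then 1 else 0 :: int)" for y
        using inside by (auto simp: of_bool_def)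
      then have "(\<Sum>y\<in>{-int n..int n}. \<Sum>x\<in>{-int n..int n}. of_bool (x = u \<and> y = v)) =
          (\<Sum>y\<in>{-int n..int n}. if y = v then 1 else 0 :: int)" by (intro sum.cong refl)
      moreover have "v \<in> {-int n..int n}" using inside by auto
      ultimately show ?thesis by simp
    qed
    moreover have "(\<Sum>y\<in>{-int n..int n}. \<Sum>x\<in>{-int n..int n}. h x y - vac y) =
        (\<Sum>y\<in>{-int n..int n}. \<Sum>x\<in>{-int n..int n}. (h' x y - vac y) + of_bool (x = u \<and> y = v))"
      by (intro sum.cong refl) (simp add: h'_def)
    ultimately show ?thesis unfolding e[OF h] e[OF h'] of_nat_Suc sum.distrib by simp
  qed
  then have exc: "excess n h = Suc (excess n h')" by linarith
  define a b where "a = u - 1" and "b = v - 1"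
  have cells: "in_aztec n a b" "in_aztec n (a + 1) b" "in_aztec n a (b + 1)" "in_aztec n (a + 1) (b + 1)"
    using inside by (auto simp: in_aztec_def a_def b_def)
  have uv_ab: "u = a + 1" "v = b + 1" by (simp_all add: a_def b_def)
  have V: "vdomino c d \<in> tiling_of n g \<longleftrightarrow> g c (d + 1) \<noteq> g (c + 1) (d + 1)" for c d g
    by (rule vdomino_in_tiling_of)
  have other_v: "vdomino c d \<in> tiling_of n h \<longleftrightarrow> vdomino c d \<in> tiling_of n h'"
    if "\<not> (d = b \<and> (c = a \<or> c = a + 1))" for c d
    using that by (auto simp: V h'_def uv_ab)
  have other_h: "hdomino c d \<in> tiling_of n h \<longleftrightarrow> hdomino c d \<in> tiling_of n h'"
    if "\<not> (c = a \<and> (d = b \<or> d = b + 1))" for c d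
    using that by (auto simp: hdomino_in_tiling_of crossed_def h'_def uv_ab)
  define P where "P \<longleftrightarrow> odd (u + v + int n)"
  have g_v: "vdomino a b \<in> tiling_of n g \<longleftrightarrow> g (u - 1) v \<noteq> g u v"
    "vdomino (a + 1) b \<in> tiling_of n g \<longleftrightarrow> g u v \<noteq> g (u + 1) v" for g
    by (simp_all add: V a_def b_def)
  have g_h: "hdomino a b \<in> tiling_of n g \<longleftrightarrow> g u v - g u (v - 1) = of_bool (\<not> P)"
    "hdomino a (b + 1) \<in> tiling_of n g \<longleftrightarrow> g u (v + 1) - g u v = of_bool P" for g
  proof -
    have "odd (u + (v - 1) + int n) \<longleftrightarrow> \<not> P" unfolding P_def by presburger
    then show "hdomino a b \<in> tiling_of n g \<longleftrightarrow> g u v - g u (v - 1) = of_bool (\<not> P)"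
      using cells by (simp add: hdomino_in_tiling_of crossed_def a_def b_def)
    show "hdomino a (b + 1) \<in> tiling_of n g \<longleftrightarrow> g u (v + 1) - g u v = of_bool P"
      using cells by (simp add: hdomino_in_tiling_of crossed_def a_def b_def P_def)
  qed
  have h'_uv: "h' u v = h u v - 1" "h' (u - 1) v = h (u - 1) v" "h' (u + 1) v = h (u + 1) v"
    "h' u (v - 1) = h u (v - 1)" "h' u (v + 1) = h u (v + 1)" by (simp_all add: h'_def)
  have block_v: "vdomino c b \<in> tiling_of n h \<longleftrightarrow> P" "vdomino c b \<in> tiling_of n h' \<longleftrightarrow> \<not> P"
    if "c = a \<or> c = a + 1" for c
    using that uv(4,5) unfolding P_def[symmetric] by (cases P; auto simp: g_v h'_uv)+
  have block_h: "hdomino a d \<in> tiling_of n h \<longleftrightarrow> \<not> P" "hdomino a d \<in> tiling_of n h' \<longleftrightarrow> P"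
    if "d = b \<or> d = b + 1" for d
    using that uv(2,3) by (cases P; auto simp: g_h h'_uv)+
  have set_eq: "tiling_of n h = A"
    if "\<And>D. D \<in> A \<Longrightarrow> domino D" "\<And>c d. hdomino c d \<in> tiling_of n h \<longleftrightarrow> hdomino c d \<in> A"
      "\<And>c d. vdomino c d \<in> tiling_of n h \<longleftrightarrow> vdomino c d \<in> A" for A
  proof (rule set_eqI)
    fix D
    show "D \<in> tiling_of n h \<longleftrightarrow> D \<in> A"
    proof (cases "domino D")
      case True
      then show ?thesis by (cases rule: dominoE) (simp_all add: that(2,3))
    next
      case False
      then show ?thesis using that(1) by (auto simp: tiling_of_def)
    qed
  qed
  have dom': "D \<in> tiling_of n h' \<Longrightarrow> domino D" for D by (auto simp: tiling_of_def)
  have "(tiling_of n h', tiling_of n h) \<in> elementary_moves (aztec_diamond n)"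
  proof (cases P)
    case True
    have "hblock a b \<subseteq> tiling_of n h'" using block_h True by (simp add: hblock_def)
    moreover have "tiling_of n h = (tiling_of n h' - hblock a b) \<union> vblock a b"
    proof (rule set_eq)
      show "domino D" if "D \<in> (tiling_of n h' - hblock a b) \<union> vblock a b" for D
        using that dom' by (auto simp: vblock_def)
      show "hdomino c d \<in> tiling_of n h \<longleftrightarrow> hdomino c d \<in> (tiling_of n h' - hblock a b) \<union> vblock a b" for c d
        using block_h(1) other_h[of c d] True by (auto simp: hblock_def vblock_def)
      show "vdomino c d \<in> tiling_of n h \<longleftrightarrow> vdomino c d \<in> (tiling_of n h' - hblock a b) \<union> vblock a b" for c d
        using block_v(1) other_v[of d c] True by (auto simp: hblock_def vblock_def)
    qed
    ultimately show ?thesis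
      using tiling_of_is_tiling[OF h] tiling_of_is_tiling[OF h'] unfolding elementary_moves_def by blast
  next
    case False
    have "vblock a b \<subseteq> tiling_of n h'" using block_v False by (simp add: vblock_def)
    moreover have "tiling_of n h = (tiling_of n h' - vblock a b) \<union> hblock a b"
    proof (rule set_eq)
      show "domino D" if "D \<in> (tiling_of n h' - vblock a b) \<union> hblock a b" for D
        using that dom' by (auto simp: hblock_def)
      show "hdomino c d \<in> tiling_of n h \<longleftrightarrow> hdomino c d \<in> (tiling_of n h' - vblock a b) \<union> hblock a b" for c d
        using block_h(1) other_h[of c d] False by (auto simp: hblock_def vblock_def)
      show "vdomino c d \<in> tiling_of n h \<longleftrightarrow> vdomino c d \<in> (tiling_of n h' - vblock a b) \<union> hblock a b" for c d
        using block_v(1) other_v[of d c] False by (auto simp: hblock_def vblock_def)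
    qed
    ultimately show ?thesis
      using tiling_of_is_tiling[OF h] tiling_of_is_tiling[OF h'] unfolding elementary_moves_def by blast
  qed
  with h' exc show ?thesis by (rule that)
qed

text \<open>Rotating a block inserts or deletes two adjacent vertical dominoes. Their contributions to the row sums have
  opposite signs and cancel except at the centre of the block.\<close>

lemma height_of_block_change:
  fixes c :: int
  assumes T: "domino_tiling (aztec_diamond n) T" and T': "domino_tiling (aztec_diamond n) T'"
    and v: "\<And>x y. of_bool (vdomino x y \<in> T') =
      of_bool (vdomino x y \<in> T) + (if y = b \<and> (x = a \<or> x = a + 1) then c else 0)"
  shows "height_of n T' x y = height_of n T x y +
    (if x = a + 1 \<and> y = b + 1 then if even (a + y + int n) then c else - c else 0)"
proof -
  define m where "m = min a (- int n)"
  have vac': "height_of n S x y = vac y" if "x \<le> m" for x S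
    using that by (simp add: height_of_def m_def)
  show ?thesis
  proof (cases "x \<ge> m")
    case True
    then show ?thesis
    proof (induction x rule: int_ge_induct)
      case base
      then show ?case using vac' by (auto simp: m_def)
    next
      case (step x)
      have par: "even (a + 1 + y + int n) \<longleftrightarrow> odd (a + y + int n)" by presburger
      show ?case
        unfolding height_of_step[OF T] height_of_step[OF T'] step.IH v
        using par by auto
    qed
  next
    case False
    then have "height_of n T' x y = vac y" "height_of n T x y = vac y" by (intro vac'; simp)+
    moreover have "x \<noteq> a + 1" using False by (auto simp: m_def)
    ultimately show ?thesis by simp
  qed
qed

lemma excess_move:
  assumes "(T, T') \<in> elementary_moves (aztec_diamond n)"
  shows "excess n (height_of n T') \<le> Suc (excess n (height_of n T))"
proof -
  have T: "domino_tiling (aztec_diamond n) T" and T': "domino_tiling (aztec_diamond n) T'"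
    using assms by (auto simp: elementary_moves_def)
  obtain a b where ab: "(hblock a b \<subseteq> T \<and> T' = (T - hblock a b) \<union> vblock a b) \<or>
      (vblock a b \<subseteq> T \<and> T' = (T - vblock a b) \<union> hblock a b)"
    using assms unfolding elementary_moves_def by blast
  obtain c :: int where c: "c \<in> {1, -1}" and v: "\<And>x y. of_bool (vdomino x y \<in> T') =
      of_bool (vdomino x y \<in> T) + (if y = b \<and> (x = a \<or> x = a + 1) then c else 0)"
  proof (cases "hblock a b \<subseteq> T \<and> T' = (T - hblock a b) \<union> vblock a b")
    case True
    then have "hdomino a b \<in> T" by (auto simp: hblock_def)
    then have n: "vdomino a b \<notin> T" "vdomino (a + 1) b \<notin> T"
      using tiling_cover(1)[OF T, of a b] tiling_cover(1)[OF T, of "a + 1" b]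
      by (auto simp: coverage_def of_bool_def split: if_splits)
    have "vdomino x y \<in> T' \<longleftrightarrow> vdomino x y \<in> T \<or> y = b \<and> (x = a \<or> x = a + 1)" for x y
      using True by (auto simp: hblock_def vblock_def)
    with n show ?thesis by (intro that[of 1]) auto
  next
    case False
    then have F: "vblock a b \<subseteq> T" "T' = (T - vblock a b) \<union> hblock a b" using ab by blast+
    then have m: "vdomino a b \<in> T" "vdomino (a + 1) b \<in> T" by (auto simp: vblock_def)
    have "vdomino x y \<in> T' \<longleftrightarrow> vdomino x y \<in> T \<and> \<not> (y = b \<and> (x = a \<or> x = a + 1))" for x y
      unfolding F(2) by (auto simp: hblock_def vblock_def)
    with m show ?thesis by (intro that[of "-1"]) auto
  qed
  have le: "height_of n T' x y \<le> height_of n T x y + of_bool (x = a + 1 \<and> y = b + 1)" for x y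
    using height_of_block_change[OF T T' v, of x y] c by (auto split: if_splits)
  have one: "(\<Sum>y\<in>{-int n..int n}. \<Sum>x\<in>{-int n..int n}. of_bool (x = a + 1 \<and> y = b + 1)) \<le> (1 :: nat)"
  proof -
    have "(\<Sum>x\<in>{-int n..int n}. of_bool (x = a + 1 \<and> y = b + 1)) \<le> (if y = b + 1 then 1 else 0 :: nat)" for y
      by (auto simp: of_bool_def)
    then have "(\<Sum>y\<in>{-int n..int n}. \<Sum>x\<in>{-int n..int n}. of_bool (x = a + 1 \<and> y = b + 1)) \<le>
        (\<Sum>y\<in>{-int n..int n}. if y = b + 1 then 1 else 0 :: nat)" by (intro sum_mono)
    also have "\<dots> \<le> 1" by simp
    finally show ?thesis .
  qed
  have "nat (height_of n T' x y - vac y) \<le> nat (height_of n T x y - vac y) + of_bool (x = a + 1 \<and> y = b + 1)"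
    for x y using le[of x y] by (auto simp: of_bool_def split: if_splits)
  then have "excess n (height_of n T') \<le> (\<Sum>y\<in>{-int n..int n}. \<Sum>x\<in>{-int n..int n}.
      nat (height_of n T x y - vac y) + of_bool (x = a + 1 \<and> y = b + 1))"
    unfolding excess_def by (intro sum_mono)
  also have "\<dots> \<le> excess n (height_of n T) + 1"
    using one by (simp add: sum.distrib excess_def del: sum_of_bool_eq)
  finally show ?thesis by simp
qed

lemma excess_le_moves:
  "(all_horizontals n, T) \<in> elementary_moves (aztec_diamond n) ^^ k \<Longrightarrow> excess n (height_of n T) \<le> k"
proof (induction k arbitrary: T)
  case 0
  then have T: "T = tiling_of n (\<lambda>x. vac)" by (simp add: all_horizontals_eq)
  show ?case unfolding T height_of_tiling_of[OF vac_heights] by simp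
next
  case (Suc k)
  then obtain S where "(all_horizontals n, S) \<in> elementary_moves (aztec_diamond n) ^^ k"
    "(S, T) \<in> elementary_moves (aztec_diamond n)" by auto
  then show ?case using Suc.IH excess_move by (metis Suc_le_mono le_trans)
qed

lemma reachable_in_excess:
  "h \<in> heights n \<Longrightarrow>
    (all_horizontals n, tiling_of n h) \<in> elementary_moves (aztec_diamond n) ^^ excess n h"
proof (induction "excess n h" arbitrary: h rule: less_induct)
  case less
  show ?case
  proof (cases "h = (\<lambda>x. vac)")
    case True
    then show ?thesis by (simp add: all_horizontals_eq)
  next
    case False
    then obtain h' where h': "h' \<in> heights n" "excess n h = Suc (excess n h')"
      "(tiling_of n h', tiling_of n h) \<in> elementary_moves (aztec_diamond n)"
      using height_lower_step less.prems by blast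
    then have "(all_horizontals n, tiling_of n h') \<in> elementary_moves (aztec_diamond n) ^^ excess n h'"
      using less.hyps by simp
    then show ?thesis using h' by auto
  qed
qed

lemma tiling_rank_tiling_of:
  assumes "h \<in> heights n"
  shows "tiling_rank n (tiling_of n h) = excess n h"
  unfolding tiling_rank_def
proof (rule Least_equality)
  show "(all_horizontals n, tiling_of n h) \<in> elementary_moves (aztec_diamond n) ^^ excess n h"
    by (rule reachable_in_excess) fact
  show "excess n h \<le> k"
    if "(all_horizontals n, tiling_of n h) \<in> elementary_moves (aztec_diamond n) ^^ k" for k
    using excess_le_moves[OF that] by (simp add: height_of_tiling_of assms)
qed

text \<open>Up to a sign depending on parity, the change of the height along a horizontal edge is the excess at its odd end
  minus the excess at its even end. Summing over a row counts each point twice.\<close>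

lemma half_verticals_tiling_of:
  assumes h: "h \<in> heights n"
  shows "half_verticals (tiling_of n h) = nat (alt_excess n h)"
proof -
  note D = heightsD[OF h]
  define \<sigma> where "\<sigma> x y = (if odd (x + y + int n) then 1 else -1 :: int)" for x y
  define k where "k x y = \<sigma> x y * (h x y - vac y)" for x y
  let ?I = "{-int n..int n}"
  have "{E \<in> tiling_of n h. vertical_domino E} = (\<lambda>(x, y). vdomino x (y - 1)) ` {(x, y). h x y \<noteq> h (x + 1) y}"
  proof (intro equalityI subsetI)
    fix E assume "E \<in> {E \<in> tiling_of n h. vertical_domino E}"
    then obtain a b where "E = vdomino a b" "h a (b + 1) \<noteq> h (a + 1) (b + 1)"
      by (auto simp: tiling_of_def)
    then show "E \<in> (\<lambda>(x, y). vdomino x (y - 1)) ` {(x, y). h x y \<noteq> h (x + 1) y}"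
      by (intro image_eqI[of _ _ "(a, b + 1)"]) auto
  qed (auto simp: vdomino_in_tiling_of)
  then have "card {E \<in> tiling_of n h. vertical_domino E} = card {(x, y). h x y \<noteq> h (x + 1) y}"
    by (simp add: card_image inj_on_def)
  also have "{(x, y). h x y \<noteq> h (x + 1) y} = {p \<in> ?I \<times> ?I. h (fst p) (snd p) \<noteq> h (fst p + 1) (snd p)}"
  proof -
    have "x \<in> ?I \<and> y \<in> ?I" if "h x y \<noteq> h (x + 1) y" for x y
    proof -
      have "\<not> (\<bar>x\<bar> + \<bar>y\<bar> \<ge> int n \<and> \<bar>x + 1\<bar> + \<bar>y\<bar> \<ge> int n)"
        using D(7)[of x y] D(7)[of "x + 1" y] that by auto
      then show ?thesis by auto
    qed
    then show ?thesis by auto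
  qed
  finally have "int (card {E \<in> tiling_of n h. vertical_domino E}) =
      int (card {p \<in> ?I \<times> ?I. h (fst p) (snd p) \<noteq> h (fst p + 1) (snd p)})" by simp
  also have "\<dots> = (\<Sum>p\<in>?I \<times> ?I. of_bool (h (fst p) (snd p) \<noteq> h (fst p + 1) (snd p)))"
    by (simp add: Int_def)
  also have "\<dots> = (\<Sum>x\<in>?I. \<Sum>y\<in>?I. of_bool (h x y \<noteq> h (x + 1) y))"
    by (simp add: sum.cartesian_product case_prod_beta del: sum_of_bool_eq)
  also have "\<dots> = (\<Sum>y\<in>?I. \<Sum>x\<in>?I. of_bool (h x y \<noteq> h (x + 1) y))"
    by (rule sum.swap)
  also have "\<dots> = (\<Sum>y\<in>?I. \<Sum>x\<in>?I. k x y + k (x + 1) y)"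
  proof (intro sum.cong refl)
    fix x y
    have "\<sigma> (x + 1) y = - \<sigma> x y" unfolding \<sigma>_def by presburger
    then have "k x y + k (x + 1) y = \<sigma> x y * (h x y - h (x + 1) y)"
      by (simp add: k_def algebra_simps)
    then show "of_bool (h x y \<noteq> h (x + 1) y) = k x y + k (x + 1) y"
      using D(3-6)[of x y] by (cases "even (x + y + int n)") (auto simp: \<sigma>_def)
  qed
  also have "\<dots> = (\<Sum>y\<in>?I. 2 * (\<Sum>x\<in>?I. k x y))"
  proof (intro sum.cong refl)
    fix y
    have k0: "k (- int n) y = 0" "k (int n + 1) y = 0"
      using D(7)[of "- int n" y] D(7)[of "int n + 1" y] by (simp_all add: k_def)
    have "(\<Sum>x\<in>?I. k (x + 1) y) = (\<Sum>x\<in>{-int n + 1..int n + 1}. k x y)"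
      by (rule sum.reindex_bij_witness[of _ "\<lambda>x. x - 1" "\<lambda>x. x + 1"]) auto
    also have "\<dots> = (\<Sum>x\<in>insert (- int n) {-int n + 1..int n + 1}. k x y)"
      using k0 by simp
    also have "insert (- int n) {-int n + 1..int n + 1} = insert (int n + 1) ?I"
      by auto
    also have "(\<Sum>x\<in>insert (int n + 1) ?I. k x y) = (\<Sum>x\<in>?I. k x y)"
      using k0 by simp
    finally show "(\<Sum>x\<in>?I. k x y + k (x + 1) y) = 2 * (\<Sum>x\<in>?I. k x y)"
      by (simp add: sum.distrib)
  qed
  also have "\<dots> = 2 * alt_excess n h"
    by (simp add: alt_excess_def k_def \<sigma>_def sum_distrib_left)
  finally have "int (card {E \<in> tiling_of n h. vertical_domino E}) = 2 * alt_excess n h" .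
  then show ?thesis unfolding half_verticals_def by linarith
qed

lemma to_fract_power: "to_fract (x ^ k) = to_fract x ^ k"
  by (induction k) simp_all

lemma to_fract_prod: "to_fract (prod f A) = (\<Prod>x\<in>A. to_fract (f x))"
  by (induction A rule: infinite_finite_induct) simp_all

theorem mainTheorem1:
  fixes n :: nat
  assumes "n \<ge> 1"
  shows "(\<Sum>T | domino_tiling (aztec_diamond n) T.
            indet_x ^ half_verticals T * indet_q ^ tiling_rank n T) =
         (\<Prod>k = 0..n - 1. (1 + indet_x * indet_q ^ (2 * k + 1)) ^ (n - k))"
proof -
  define x q where "x = to_fract indet_x" and "q = to_fract indet_q"
  have q: "q \<noteq> 0" by (simp add: q_def indet_q_def)
  have "(\<Sum>T | domino_tiling (aztec_diamond n) T.
            indet_x ^ half_verticals T * indet_q ^ tiling_rank n T) =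
        (\<Sum>h\<in>heights n. indet_x ^ half_verticals (tiling_of n h) * indet_q ^ tiling_rank n (tiling_of n h))"
    by (rule sum.reindex_bij_betw[OF bij_betw_tiling_of, symmetric])
  also have "\<dots> = (\<Sum>h\<in>heights n. indet_x ^ nat (alt_excess n h) * indet_q ^ excess n h)"
    by (simp add: half_verticals_tiling_of tiling_rank_tiling_of)
  also have "to_fract \<dots> = (\<Prod>k<n. (1 + x * q ^ (2 * k + 1)) ^ (n - k))"
    using heights_gf[OF q, of x n] by (simp add: to_fract_power x_def q_def)
  also have "\<dots> = to_fract (\<Prod>k<n. (1 + indet_x * indet_q ^ (2 * k + 1)) ^ (n - k))"
    by (simp add: to_fract_power to_fract_prod x_def q_def)
  also have "{..<n} = {0..n - 1}" using assms by auto
  finally have "to_fract (\<Sum>T | domino_tiling (aztec_diamond n) T.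
            indet_x ^ half_verticals T * indet_q ^ tiling_rank n T) =
      to_fract (\<Prod>k = 0..n - 1. (1 + indet_x * indet_q ^ (2 * k + 1)) ^ (n - k))" .
  then show ?thesis by (simp only: to_fract_eq_iff)
qed

end
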